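(* Let $p,n\ge 1$ be integers and write $n=(p+1)q+s$ with $0\le s\le p$. Then the projective dimension of $R/I_p(L_{n+p-1})$ is $$\operatorname{pdim}(R/I_p(L_{n+p-1}))=\begin{cases}2q & \text{if } s=0,\\ 2q+1 & \text{if } s=1,\\ 2q+2 & \text{otherwise.}\end{cases}$$
   Context: $\Bbbk$ is any field, $R=\Bbbk[x_1,\dots,x_{n+p-1}]$, and $I_p(L_{n+p-1})$ is the $p$-path ideal of the path on the vertices $x_1,\dots,x_{n+p-1}$, i.e. the ideal generated by the $n$ monomials $m_i=x_ix_{i+1}\cdots x_{i+p-1}$, $1\le i\le n$. *)

theory Defs
  imports
    "HOL-Algebra.Algebra"
    "HOL-Library.Poly_Mapping"
    "HOL-Library.Extended_Nat"
begin

section \<open>Projective dimension of modules\<close>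

definition mod_hom ::
  "('r, 'x) ring_scheme \<Rightarrow> ('r, 'a, 'y) module_scheme \<Rightarrow> ('r, 'b, 'z) module_scheme \<Rightarrow> ('a \<Rightarrow> 'b) set"
  where
  "mod_hom R M N =
    {h \<in> carrier M \<rightarrow> carrier N.
      (\<forall>x\<in>carrier M. \<forall>y\<in>carrier M. h (x \<oplus>\<^bsub>M\<^esub> y) = h x \<oplus>\<^bsub>N\<^esub> h y) \<and>
      (\<forall>r\<in>carrier R. \<forall>x\<in>carrier M. h (r \<odot>\<^bsub>M\<^esub> x) = r \<odot>\<^bsub>N\<^esub> h x)}"

text \<open>
  Projectivity is the lifting property along surjections \<open>g : A \<rightarrow> B\<close>. A definition in HOL cannot
  quantify over types, so \<open>A\<close> and \<open>B\<close> range over the modules whose elements are of type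
  \<open>'p \<Rightarrow> 'r\<close>. This loses nothing: the type contains a copy of \<open>P\<close> and the free module on the set
  \<open>carrier P\<close> (the functions of finite support), and lifting the identity of \<open>P\<close> along the canonical
  surjection between these two already makes \<open>P\<close> a direct summand of a free module.
\<close>
definition projective_module :: "('r, 'x) ring_scheme \<Rightarrow> ('r, 'p) module \<Rightarrow> bool" where
  "projective_module R P \<longleftrightarrow>
    module R P \<and>
    (\<forall>(A :: ('r, 'p \<Rightarrow> 'r) module) (B :: ('r, 'p \<Rightarrow> 'r) module) g f.
      module R A \<and> module R B \<and>
      g \<in> mod_hom R A B \<and> g ` carrier A = carrier B \<and> f \<in> mod_hom R P B \<longrightarrow>
      (\<exists>h\<in>mod_hom R P A. \<forall>x\<in>carrier P. g (h x) = f x))"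

text \<open>
  Exactness of
  \<open>\<dots> \<rightarrow> P 2 \<rightarrow> P 1 \<rightarrow> P 0 \<rightarrow> M \<rightarrow> 0\<close>, with \<open>d i : P (Suc i) \<rightarrow> P i\<close> and augmentation \<open>e : P 0 \<rightarrow> M\<close>.
\<close>
definition projective_resolution ::
  "('r, 'x) ring_scheme \<Rightarrow> ('r, 'm, 'y) module_scheme \<Rightarrow>
    (nat \<Rightarrow> ('r, 'p) module) \<Rightarrow> (nat \<Rightarrow> 'p \<Rightarrow> 'p) \<Rightarrow> ('p \<Rightarrow> 'm) \<Rightarrow> bool"
  where
  "projective_resolution R M P d e \<longleftrightarrow>
    (\<forall>i. projective_module R (P i)) \<and>
    e \<in> mod_hom R (P 0) M \<and>
    (\<forall>i. d i \<in> mod_hom R (P (Suc i)) (P i)) \<and>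
    e ` carrier (P 0) = carrier M \<and>
    a_kernel (P 0) M e = d 0 ` carrier (P (Suc 0)) \<and>
    (\<forall>i. a_kernel (P (Suc i)) (P i) (d i) = d (Suc i) ` carrier (P (Suc (Suc i))))"

text \<open>
  The infimum of the lengths of the projective resolutions of \<open>M\<close>, which is \<open>\<infinity>\<close> if no finite one
  exists. The modules of a resolution have elements of type \<open>nat \<Rightarrow> 'm \<Rightarrow> 'r\<close>; again this loses
  nothing. If \<open>M\<close> has projective dimension at most \<open>l\<close>, then in a resolution by free modules on
  generating sets of cardinality at most \<open>max \<aleph>\<^sub>0 \<bar>M\<bar> \<bar>R\<bar>\<close> the \<open>l\<close>-th syzygy is projective, and all
  modules involved have at most that cardinality, hence embed into the type if \<open>R\<close> is nonzero.
\<close>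
definition pdim :: "('r, 'x) ring_scheme \<Rightarrow> ('r, 'm, 'y) module_scheme \<Rightarrow> enat" where
  "pdim R M =
    Inf {enat l | l.
      \<exists>(P :: nat \<Rightarrow> ('r, nat \<Rightarrow> 'm \<Rightarrow> 'r) module) d e.
        projective_resolution R M P d e \<and> (\<forall>i>l. carrier (P i) = {\<zero>\<^bsub>P i\<^esub>})}"

text \<open>The ring \<open>R Quot I\<close> regarded as an \<open>R\<close>-module, with \<open>r \<odot> (I +> a) = I +> (r \<otimes> a)\<close>.\<close>
definition quot_module :: "('r, 'x) ring_scheme \<Rightarrow> 'r set \<Rightarrow> ('r, 'r set) module" where
  "quot_module R I =
    ring.extend (R Quot I) (module.fields (\<lambda>r A. (I +>\<^bsub>R\<^esub> r) \<otimes>\<^bsub>R Quot I\<^esub> A))"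


section \<open>Path ideals of path graphs\<close>

text \<open>
  The polynomial ring in the variables \<open>x\<^sub>1, \<dots>, x\<^sub>N\<close> over the field \<open>'k\<close>: exponent vectors are
  finitely supported functions on \<open>nat\<close>, and only the indices \<open>1, \<dots>, N\<close> may occur.
\<close>
definition mpoly_ring :: "nat \<Rightarrow> ((nat \<Rightarrow>\<^sub>0 nat) \<Rightarrow>\<^sub>0 'k::field) ring" where
  "mpoly_ring N =
    \<lparr>carrier = {f. \<forall>m\<in>Poly_Mapping.keys f. Poly_Mapping.keys m \<subseteq> {1..N}},
      monoid.mult = (*), one = 1, ring.zero = 0, add = (+)\<rparr>"

definition mvar :: "nat \<Rightarrow> ((nat \<Rightarrow>\<^sub>0 nat) \<Rightarrow>\<^sub>0 'k::field)" where
  "mvar i = Poly_Mapping.single (Poly_Mapping.single i 1) 1"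

text \<open>
  \<open>path_ideal p N\<close> is the \<open>p\<close>-path ideal of the path on \<open>x\<^sub>1, \<dots>, x\<^sub>N\<close>: its generators are the products
  of \<open>p\<close> consecutive variables \<open>x\<^sub>i, \<dots>, x\<^bsub>i+p-1\<^esub>\<close>, where \<open>1 \<le> i\<close> and \<open>i + p - 1 \<le> N\<close>.
\<close>
definition path_ideal :: "nat \<Rightarrow> nat \<Rightarrow> ((nat \<Rightarrow>\<^sub>0 nat) \<Rightarrow>\<^sub>0 'k::field) set" where
  "path_ideal p N =
    genideal (mpoly_ring N) {\<Prod>j\<in>{i..<i + p}. mvar j | i. 1 \<le> i \<and> i + p \<le> N + 1}"

end

theory Submission
  imports Defs
begin

text \<open>
  Write \<open>I\<^sub>k\<close> for the ideal of the first \<open>k\<close> generators \<open>m\<^sub>1, \<dots>, m\<^sub>k\<close>. For \<open>k \<ge> 2\<close> the colon ideal \<open>I\<^bsub>k-1\<^esub> : m\<^sub>k\<close>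
  is \<open>(x\<^bsub>k-1\<^esub>) + I\<^bsub>k-1-p\<^esub>\<close>, so \<open>R/I\<^sub>k\<close> is the cokernel of \<open>m\<^sub>k : R/((x\<^bsub>k-1\<^esub>) + I\<^bsub>k-1-p\<^esub>) \<rightarrow> R/I\<^bsub>k-1\<^esub>\<close>. Two
  mapping cones, one adjoining \<open>x\<^bsub>k-1\<^esub>\<close> and one adjoining \<open>m\<^sub>k\<close>, build a free resolution of \<open>R/I\<^sub>k\<close> from those
  of \<open>R/I\<^bsub>k-1\<^esub>\<close> and \<open>R/I\<^bsub>k-1-p\<^esub>\<close>. The last variable of \<open>m\<^sub>k\<close> does not occur in \<open>I\<^bsub>k-1\<^esub>\<close> and can be factored out of
  the comparison map, hence the cones stay minimal and the lengths obey \<open>f k = f (k - 1 - p) + 2\<close>.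
  The length of a minimal finite free resolution is the projective dimension: comparing it with a
  shorter projective resolution would make a unit lie in the irrelevant ideal.
\<close>

section \<open>Module homomorphisms and projectivity\<close>

lemma mod_homI:
  assumes "\<And>x. x \<in> carrier M \<Longrightarrow> h x \<in> carrier N"
    and "\<And>x y. x \<in> carrier M \<Longrightarrow> y \<in> carrier M \<Longrightarrow> h (x \<oplus>\<^bsub>M\<^esub> y) = h x \<oplus>\<^bsub>N\<^esub> h y"
    and "\<And>r x. r \<in> carrier R \<Longrightarrow> x \<in> carrier M \<Longrightarrow> h (r \<odot>\<^bsub>M\<^esub> x) = r \<odot>\<^bsub>N\<^esub> h x"
  shows "h \<in> mod_hom R M N"
  using assms by (auto simp: mod_hom_def)

lemma mod_homD:
  assumes "h \<in> mod_hom R M N"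
  shows "x \<in> carrier M \<Longrightarrow> h x \<in> carrier N"
    and "x \<in> carrier M \<Longrightarrow> y \<in> carrier M \<Longrightarrow> h (x \<oplus>\<^bsub>M\<^esub> y) = h x \<oplus>\<^bsub>N\<^esub> h y"
    and "r \<in> carrier R \<Longrightarrow> x \<in> carrier M \<Longrightarrow> h (r \<odot>\<^bsub>M\<^esub> x) = r \<odot>\<^bsub>N\<^esub> h x"
  using assms by (auto simp: mod_hom_def)

lemma mod_hom_comp:
  assumes "h \<in> mod_hom R M N" and "g \<in> mod_hom R N Q"
  shows "(\<lambda>x. g (h x)) \<in> mod_hom R M Q"
  by (rule mod_homI) (simp_all add: mod_homD[OF assms(1)] mod_homD[OF assms(2)])

lemma mod_hom_zero:
  assumes "module R M" and "module R N" and "h \<in> mod_hom R M N"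
  shows "h \<zero>\<^bsub>M\<^esub> = \<zero>\<^bsub>N\<^esub>"
proof -
  interpret M: module R M by fact
  interpret N: module R N by fact
  have "h (\<zero>\<^bsub>R\<^esub> \<odot>\<^bsub>M\<^esub> \<zero>\<^bsub>M\<^esub>) = \<zero>\<^bsub>R\<^esub> \<odot>\<^bsub>N\<^esub> h \<zero>\<^bsub>M\<^esub>"
    by (rule mod_homD(3)[OF assms(3)]) auto
  then show ?thesis
    using mod_homD(1)[OF assms(3)] by simp
qed

lemma submodule_mod_hom_image:
  assumes "module R M" and "module R N" and h: "h \<in> mod_hom R M N"
  shows "submodule (h ` carrier M) R N"
proof -
  interpret M: module R M by fact
  interpret N: module R N by fact
  show ?thesis
  proof (rule N.submoduleI)
    show "h ` carrier M \<subseteq> carrier N"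
      using mod_homD(1)[OF h] by auto
    show "\<zero>\<^bsub>N\<^esub> \<in> h ` carrier M"
      using mod_hom_zero[OF assms] by (metis M.zero_closed imageI)
    show "a \<oplus>\<^bsub>N\<^esub> b \<in> h ` carrier M" if "a \<in> h ` carrier M" "b \<in> h ` carrier M" for a b
      using that by (auto simp flip: mod_homD(2)[OF h])
    show smult: "r \<odot>\<^bsub>N\<^esub> a \<in> h ` carrier M" if "r \<in> carrier R" "a \<in> h ` carrier M" for r a
      using that by (auto simp flip: mod_homD(3)[OF h])
    show "\<ominus>\<^bsub>N\<^esub> a \<in> h ` carrier M" if "a \<in> h ` carrier M" for a
    proof -
      have "a \<in> carrier N"
        using that mod_homD(1)[OF h] by auto
      then have "\<ominus>\<^bsub>N\<^esub> a = (\<ominus>\<^bsub>R\<^esub> \<one>\<^bsub>R\<^esub>) \<odot>\<^bsub>N\<^esub> a"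
        by (simp add: N.smult_l_minus)
      then show ?thesis
        using smult[of "\<ominus>\<^bsub>R\<^esub> \<one>\<^bsub>R\<^esub>" a] that by simp
    qed
  qed
qed

section \<open>Copies of a module on another element type\<close>

definition transport :: "('a \<Rightarrow> 'b) \<Rightarrow> ('r, 'a, 'y) module_scheme \<Rightarrow> ('r, 'b) module" where
  "transport h M =
    \<lparr>carrier = h ` carrier M, monoid.mult = undefined, one = undefined, ring.zero = h \<zero>\<^bsub>M\<^esub>,
      add = \<lambda>x y. h (inv_into (carrier M) h x \<oplus>\<^bsub>M\<^esub> inv_into (carrier M) h y),
      smult = \<lambda>r x. h (r \<odot>\<^bsub>M\<^esub> inv_into (carrier M) h x)\<rparr>"

lemma transport_simps:
  "carrier (transport h M) = h ` carrier M"
  "\<zero>\<^bsub>transport h M\<^esub> = h \<zero>\<^bsub>M\<^esub>"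
  "x \<oplus>\<^bsub>transport h M\<^esub> y = h (inv_into (carrier M) h x \<oplus>\<^bsub>M\<^esub> inv_into (carrier M) h y)"
  "r \<odot>\<^bsub>transport h M\<^esub> x = h (r \<odot>\<^bsub>M\<^esub> inv_into (carrier M) h x)"
  by (simp_all add: transport_def)

lemma transport_hom:
  assumes "inj_on h (carrier M)"
  shows "h \<in> mod_hom R M (transport h M)"
  by (rule mod_homI) (simp_all add: transport_simps assms)

lemma transport_inv_hom:
  assumes "module R M" and "inj_on h (carrier M)"
  shows "inv_into (carrier M) h \<in> mod_hom R (transport h M) M"
proof -
  interpret M: module R M by fact
  show ?thesis
    by (rule mod_homI) (auto simp: transport_simps assms(2))
qed

lemma module_transport:
  assumes "module R M" and inj: "inj_on h (carrier M)"
  shows "module R (transport h M)"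
proof -
  interpret M: module R M by fact
  show ?thesis
  proof (rule moduleI)
    show "cring R" by (rule M.R.is_cring)
    show "abelian_group (transport h M)"
    proof (rule abelian_groupI)
      fix x assume "x \<in> carrier (transport h M)"
      then obtain a where a: "a \<in> carrier M" "x = h a"
        by (auto simp: transport_simps)
      have "h (\<ominus>\<^bsub>M\<^esub> a) \<oplus>\<^bsub>transport h M\<^esub> x = \<zero>\<^bsub>transport h M\<^esub>"
        using a by (simp add: transport_simps inj M.M.l_neg)
      then show "\<exists>y\<in>carrier (transport h M). y \<oplus>\<^bsub>transport h M\<^esub> x = \<zero>\<^bsub>transport h M\<^esub>"
        using a by (auto simp: transport_simps)
    qed (auto simp: transport_simps inj M.M.a_ac)
  qed (auto simp: transport_simps inj M.smult_l_distr M.smult_r_distr M.smult_assoc1)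
qed

text \<open>
  Frees the lifting property from the type of test modules in the definition of projectivity:
  along injections, every smaller test module is a module of that type.
\<close>
lemma projective_lift:
  fixes R :: "('r, 'x) ring_scheme" and P :: "('r, 'p) module"
    and A :: "('r, 'a, 'y) module_scheme" and B :: "('r, 'b, 'z) module_scheme"
    and ia :: "'a \<Rightarrow> 'p \<Rightarrow> 'r" and ib :: "'b \<Rightarrow> 'p \<Rightarrow> 'r"
  assumes P: "projective_module R P" and A: "module R A" and B: "module R B"
    and ia: "inj ia" and ib: "inj ib"
    and g: "g \<in> mod_hom R A B" and f: "f \<in> mod_hom R P B"
    and img: "f ` carrier P \<subseteq> g ` carrier A"
  shows "\<exists>h\<in>mod_hom R P A. \<forall>x\<in>carrier P. g (h x) = f x"
proof -
  \<comment> \<open>The definition of projectivity asks for a surjection, so the target shrinks to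
    the image of \<open>g\<close>; by \<open>img\<close> it still receives \<open>f\<close>.\<close>
  define B' where "B' = B\<lparr>carrier := g ` carrier A\<rparr>"
  have B': "module R B'"
    unfolding B'_def
    by (rule submodule.submodule_is_module[OF submodule_mod_hom_image[OF A B g] B])
  have g': "g \<in> mod_hom R A B'" and f': "f \<in> mod_hom R P B'"
    using g f img by (auto simp: mod_hom_def B'_def)
  have injA: "inj_on ia (carrier A)" and injB: "inj_on ib (carrier B')"
    using ia ib by (auto intro: inj_on_subset)
  define TA where "TA = transport ia A"
  define TB where "TB = transport ib B'"
  define ja where "ja = inv_into (carrier A) ia"
  have ja: "ja \<in> mod_hom R TA A"
    unfolding ja_def TA_def by (rule transport_inv_hom[OF A injA])
  have ib': "ib \<in> mod_hom R B' TB"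
    unfolding TB_def by (rule transport_hom[OF injB])
  have TA: "module R TA" and TB: "module R TB"
    unfolding TA_def TB_def using module_transport A B' injA injB by auto
  have 1: "(\<lambda>x. ib (g (ja x))) \<in> mod_hom R TA TB"
    by (rule mod_hom_comp[OF mod_hom_comp[OF ja g'] ib'])
  have 2: "(\<lambda>x. ib (f x)) \<in> mod_hom R P TB"
    by (rule mod_hom_comp[OF f' ib'])
  have jaimg: "ja ` carrier TA = carrier A"
    unfolding ja_def TA_def transport_simps using injA by force
  have "(\<lambda>x. ib (g (ja x))) ` carrier TA = ib ` g ` (ja ` carrier TA)"
    by auto
  also have "\<dots> = carrier TB"
    unfolding jaimg by (simp add: TB_def transport_simps B'_def)
  finally have 3: "(\<lambda>x. ib (g (ja x))) ` carrier TA = carrier TB" .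
  obtain h where h: "h \<in> mod_hom R P TA" and gh: "\<forall>x\<in>carrier P. ib (g (ja (h x))) = ib (f x)"
    using P TA TB 1 2 3 unfolding projective_module_def by blast
  have "\<forall>x\<in>carrier P. g (ja (h x)) = f x"
    using gh ib by (auto dest: injD)
  then show ?thesis
    by (rule bexI[OF _ mod_hom_comp[OF h ja]])
qed

section \<open>Free modules over a unital subring\<close>

definition ring_of :: "'r::comm_ring_1 set \<Rightarrow> 'r ring" where
  "ring_of S = \<lparr>carrier = S, monoid.mult = (*), one = 1, ring.zero = 0, add = (+)\<rparr>"

text \<open>For finite \<open>B\<close>, the free module with basis \<open>B\<close>. All ranks live
  in the single type \<open>nat \<Rightarrow> 'r\<close>, so a complex is a plain family of modules
  with a common element type.\<close>

definition free_mod :: "'r::comm_ring_1 set \<Rightarrow> nat set \<Rightarrow> ('r, nat \<Rightarrow> 'r) module" where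
  "free_mod S B =
    \<lparr>carrier = {v. (\<forall>j. v j \<in> S) \<and> (\<forall>j. j \<notin> B \<longrightarrow> v j = 0)},
      monoid.mult = undefined, one = undefined, ring.zero = \<lambda>_. 0,
      add = \<lambda>v w j. v j + w j, smult = \<lambda>r v j. r * v j\<rparr>"

locale unital_subring =
  fixes S :: "'r::comm_ring_1 set"
  assumes zero_mem [simp]: "0 \<in> S" and one_mem [simp]: "1 \<in> S"
    and add_mem [simp]: "a \<in> S \<Longrightarrow> b \<in> S \<Longrightarrow> a + b \<in> S"
    and uminus_mem [simp]: "a \<in> S \<Longrightarrow> - a \<in> S"
    and mult_mem [simp]: "a \<in> S \<Longrightarrow> b \<in> S \<Longrightarrow> a * b \<in> S"
begin

abbreviation "R \<equiv> ring_of S"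
abbreviation "Fr \<equiv> free_mod S"

lemma diff_mem [simp]: "a \<in> S \<Longrightarrow> b \<in> S \<Longrightarrow> a - b \<in> S"
  using add_mem[of a "- b"] by simp

lemma ring_of_simps [simp]:
  "carrier R = S" "a \<otimes>\<^bsub>R\<^esub> b = a * b" "\<one>\<^bsub>R\<^esub> = 1" "\<zero>\<^bsub>R\<^esub> = 0" "a \<oplus>\<^bsub>R\<^esub> b = a + b"
  by (simp_all add: ring_of_def)

lemma cring_ring_of: "cring R"
proof (rule cringI)
  show "abelian_group R"
  proof (rule abelian_groupI)
    show "\<exists>y\<in>carrier R. y \<oplus>\<^bsub>R\<^esub> x = \<zero>\<^bsub>R\<^esub>" if "x \<in> carrier R" for x
      using that by (intro bexI[of _ "- x"]) simp_all
  qed (simp_all add: algebra_simps)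
  show "Group.comm_monoid R"
    by (rule comm_monoidI) (simp_all add: algebra_simps)
qed (simp_all add: algebra_simps)

lemma free_simps [simp]:
  "carrier (Fr B) = {v. (\<forall>j. v j \<in> S) \<and> (\<forall>j. j \<notin> B \<longrightarrow> v j = 0)}"
  "\<zero>\<^bsub>Fr B\<^esub> = (\<lambda>_. 0)"
  "v \<oplus>\<^bsub>Fr B\<^esub> w = (\<lambda>j. v j + w j)"
  "r \<odot>\<^bsub>Fr B\<^esub> v = (\<lambda>j. r * v j)"
  by (simp_all add: free_mod_def)

lemma module_free: "module R (Fr B)"
proof (rule moduleI)
  show "abelian_group (Fr B)"
  proof (rule abelian_groupI)
    show "\<exists>y\<in>carrier (Fr B). y \<oplus>\<^bsub>Fr B\<^esub> x = \<zero>\<^bsub>Fr B\<^esub>" if "x \<in> carrier (Fr B)" for x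
      using that by (intro bexI[of _ "\<lambda>j. - x j"]) simp_all
  qed (auto simp: algebra_simps)
qed (auto simp: cring_ring_of algebra_simps)

text \<open>Preimages of the values of \<open>f\<close> at the basis vectors determine a lift; the
  induction adds one basis vector at a time. It suffices that \<open>g\<close> reaches the image of
  \<open>f\<close>.\<close>

lemma free_lift:
  assumes "finite B" and M: "module R M" and N: "module R N"
    and g: "g \<in> mod_hom R M N" and "f \<in> mod_hom R (Fr B) N"
    and "f ` carrier (Fr B) \<subseteq> g ` carrier M"
  shows "\<exists>h\<in>mod_hom R (Fr B) M. \<forall>v\<in>carrier (Fr B). g (h v) = f v"
proof -
  interpret M: module R M by fact
  interpret N: module R N by fact
  show ?thesis
    using assms(1,5,6)
  proof (induction B arbitrary: f)
    case empty
    have "(\<lambda>_. \<zero>\<^bsub>M\<^esub>) \<in> mod_hom R (Fr {}) M"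
      by (rule mod_homI) auto
    moreover have "g \<zero>\<^bsub>M\<^esub> = f (\<lambda>_. 0)"
      using mod_hom_zero[OF M N g] mod_hom_zero[OF module_free N empty(1)] by simp
    then have "\<forall>v\<in>carrier (Fr {}). g \<zero>\<^bsub>M\<^esub> = f v"
      by auto (metis ext)
    ultimately show ?case by - (rule bexI[where x = "\<lambda>_. \<zero>\<^bsub>M\<^esub>"])
  next
    case (insert b B)
    note f = insert.prems(1) and img = insert.prems(2)
    have sub: "carrier (Fr B) \<subseteq> carrier (Fr (insert b B))"
      by auto
    have "f \<in> mod_hom R (Fr B) N"
      using f by (auto simp: mod_hom_def)
    then obtain h where h: "h \<in> mod_hom R (Fr B) M" and gh: "\<forall>v\<in>carrier (Fr B). g (h v) = f v"
      using insert.IH[of f] img sub by blast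
    define e :: "nat \<Rightarrow> 'r" where "e = (\<lambda>j. if j = b then 1 else 0)"
    have e: "e \<in> carrier (Fr (insert b B))"
      by (auto simp: e_def)
    then obtain a where a: "a \<in> carrier M" "g a = f e"
      using img by (metis image_iff subsetD)
    \<comment> \<open>Off \<open>b\<close> this is the lift from the induction hypothesis; the basis
      vector \<open>e\<close> goes to the chosen preimage \<open>a\<close>.\<close>
    define k where "k v = h (v(b := 0)) \<oplus>\<^bsub>M\<^esub> v b \<odot>\<^bsub>M\<^esub> a" for v
    have upd: "v(b := 0) \<in> carrier (Fr B)" if "v \<in> carrier (Fr (insert b B))" for v
      using that by auto
    note hc = mod_homD(1)[OF h]
    have S: "v j \<in> S" if "v \<in> carrier (Fr C)" for v C j
      using that by simp
    have "k \<in> mod_hom R (Fr (insert b B)) M"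
    proof (rule mod_homI)
      fix v assume v: "v \<in> carrier (Fr (insert b B))"
      show "k v \<in> carrier M"
        unfolding k_def using hc[OF upd[OF v]] a S[OF v] by simp
      show "k (r \<odot>\<^bsub>Fr (insert b B)\<^esub> v) = r \<odot>\<^bsub>M\<^esub> k v" if r: "r \<in> carrier R" for r
      proof -
        have eq: "(r \<odot>\<^bsub>Fr (insert b B)\<^esub> v)(b := 0) = r \<odot>\<^bsub>Fr B\<^esub> v(b := 0)"
          by auto
        have "k (r \<odot>\<^bsub>Fr (insert b B)\<^esub> v) = r \<odot>\<^bsub>M\<^esub> h (v(b := 0)) \<oplus>\<^bsub>M\<^esub> (r * v b) \<odot>\<^bsub>M\<^esub> a"
          unfolding k_def eq mod_homD(3)[OF h r upd[OF v]] by simp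
        also have "(r * v b) \<odot>\<^bsub>M\<^esub> a = r \<odot>\<^bsub>M\<^esub> (v b \<odot>\<^bsub>M\<^esub> a)"
          using M.smult_assoc1[OF r _ a(1), of "v b"] S[OF v] by simp
        also have "r \<odot>\<^bsub>M\<^esub> h (v(b := 0)) \<oplus>\<^bsub>M\<^esub> r \<odot>\<^bsub>M\<^esub> (v b \<odot>\<^bsub>M\<^esub> a) = r \<odot>\<^bsub>M\<^esub> k v"
          unfolding k_def using r a hc[OF upd[OF v]] S[OF v] by (simp add: M.smult_r_distr)
        finally show ?thesis .
      qed
      fix w assume w: "w \<in> carrier (Fr (insert b B))"
      have eq: "(v \<oplus>\<^bsub>Fr (insert b B)\<^esub> w)(b := 0) = v(b := 0) \<oplus>\<^bsub>Fr B\<^esub> w(b := 0)"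
        by auto
      have "k (v \<oplus>\<^bsub>Fr (insert b B)\<^esub> w)
        = (h (v(b := 0)) \<oplus>\<^bsub>M\<^esub> h (w(b := 0))) \<oplus>\<^bsub>M\<^esub> (v b + w b) \<odot>\<^bsub>M\<^esub> a"
        unfolding k_def eq mod_homD(2)[OF h upd[OF v] upd[OF w]] by simp
      also have "(v b + w b) \<odot>\<^bsub>M\<^esub> a = v b \<odot>\<^bsub>M\<^esub> a \<oplus>\<^bsub>M\<^esub> w b \<odot>\<^bsub>M\<^esub> a"
        using M.smult_l_distr[OF _ _ a(1), of "v b" "w b"] S[OF v] S[OF w] by simp
      also have "(h (v(b := 0)) \<oplus>\<^bsub>M\<^esub> h (w(b := 0))) \<oplus>\<^bsub>M\<^esub> (v b \<odot>\<^bsub>M\<^esub> a \<oplus>\<^bsub>M\<^esub> w b \<odot>\<^bsub>M\<^esub> a)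
        = k v \<oplus>\<^bsub>M\<^esub> k w"
        unfolding k_def using a hc[OF upd[OF v]] hc[OF upd[OF w]] S[OF v] S[OF w]
        by (simp add: M.M.a_ac)
      finally show "k (v \<oplus>\<^bsub>Fr (insert b B)\<^esub> w) = k v \<oplus>\<^bsub>M\<^esub> k w" .
    qed
    moreover have "g (k v) = f v" if v: "v \<in> carrier (Fr (insert b B))" for v
    proof -
      have "g (k v) = g (h (v(b := 0))) \<oplus>\<^bsub>N\<^esub> v b \<odot>\<^bsub>N\<^esub> g a"
        unfolding k_def using a hc[OF upd[OF v]] S[OF v] by (simp add: mod_homD[OF g])
      also have "\<dots> = f (v(b := 0)) \<oplus>\<^bsub>N\<^esub> f (v b \<odot>\<^bsub>Fr (insert b B)\<^esub> e)"
        using gh upd[OF v] a mod_homD(3)[OF f _ e, of "v b"] S[OF v] by simp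
      also have "\<dots> = f (v(b := 0) \<oplus>\<^bsub>Fr (insert b B)\<^esub> v b \<odot>\<^bsub>Fr (insert b B)\<^esub> e)"
        using v by (intro mod_homD(2)[OF f, symmetric]) (auto simp: e_def)
      also have "v(b := 0) \<oplus>\<^bsub>Fr (insert b B)\<^esub> v b \<odot>\<^bsub>Fr (insert b B)\<^esub> e = v"
        by (auto simp: e_def)
      finally show ?thesis .
    qed
    ultimately show ?case by blast
  qed
qed

text \<open>\<open>free_lift\<close> works on \<open>Fr B\<close> itself, and composing with the
  inverse of \<open>h\<close> moves the lift to the copy. The copy serves \<open>pdim\<close>, whose
  resolutions live in a prescribed element type.\<close>

lemma projective_free:
  assumes "finite B" and inj: "inj_on h (carrier (Fr B))"
  shows "projective_module R (transport h (Fr B))"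
  unfolding projective_module_def
proof (intro conjI allI impI)
  show "module R (transport h (Fr B))"
    by (rule module_transport[OF module_free inj])
next
  fix A C :: "('r, 'b \<Rightarrow> 'r) module" and g f
  assume *: "module R A \<and> module R C \<and> g \<in> mod_hom R A C \<and> g ` carrier A = carrier C \<and>
    f \<in> mod_hom R (transport h (Fr B)) C"
  then have f: "(\<lambda>v. f (h v)) \<in> mod_hom R (Fr B) C"
    using mod_hom_comp[OF transport_hom[OF inj]] by blast
  have img: "(\<lambda>v. f (h v)) ` carrier (Fr B) \<subseteq> g ` carrier A"
    using * mod_homD(1)[OF f] by blast
  have A: "module R A" and C: "module R C" and g: "g \<in> mod_hom R A C"
    using * by blast+
  have "\<exists>k\<in>mod_hom R (Fr B) A. \<forall>v\<in>carrier (Fr B). g (k v) = f (h v)"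
    by (rule free_lift[OF assms(1) A C g f img])
  then obtain k where k: "k \<in> mod_hom R (Fr B) A" "\<forall>v\<in>carrier (Fr B). g (k v) = f (h v)"
    by blast
  let ?j = "inv_into (carrier (Fr B)) h"
  have kj: "(\<lambda>x. k (?j x)) \<in> mod_hom R (transport h (Fr B)) A"
    by (rule mod_hom_comp[OF transport_inv_hom[OF module_free inj] k(1)])
  have "g (k (?j x)) = f x" if "x \<in> carrier (transport h (Fr B))" for x
  proof -
    have x: "x \<in> h ` carrier (Fr B)"
      using that by (simp only: transport_simps)
    show ?thesis
      using k(2) inv_into_into[OF x] f_inv_into_f[OF x] by metis
  qed
  then show "\<exists>k\<in>mod_hom R (transport h (Fr B)) A. \<forall>x\<in>carrier (transport h (Fr B)). g (k x) = f x"
    by (intro bexI[OF ballI kj])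
qed

end

section \<open>Complexes\<close>

text \<open>
  Indexed so that exactness of an augmented complex reads uniformly in all degrees: in degree \<open>0\<close> the
  kernel of the augmentation \<open>Z\<close> takes the place of the kernel of a differential.
\<close>
definition cycles ::
  "(nat \<Rightarrow> ('r, 'a, 'y) module_scheme) \<Rightarrow> (nat \<Rightarrow> 'a \<Rightarrow> 'a) \<Rightarrow> 'a set \<Rightarrow> nat \<Rightarrow> 'a set" where
  "cycles C d Z i =
    (case i of 0 \<Rightarrow> Z | Suc k \<Rightarrow> {x \<in> carrier (C (Suc k)). d k x = \<zero>\<^bsub>C k\<^esub>})"

lemma cycles_simps:
  "cycles C d Z 0 = Z"
  "cycles C d Z (Suc k) = {x \<in> carrier (C (Suc k)). d k x = \<zero>\<^bsub>C k\<^esub>}"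
  by (simp_all add: cycles_def)

text \<open>The comparison theorem: a complex at the source, exactness at the target. The lifting
  step is a hypothesis, so that the same induction serves free sources via \<open>free_lift\<close>
  and projective ones via \<open>projective_lift\<close>.\<close>

lemma chain_map_exists:
  assumes \<phi>0: "\<phi>0 \<in> mod_hom R (C 0) (D 0)" "\<phi>0 ` Z \<subseteq> W"
    and C: "\<And>i. module R (C i)" and D: "\<And>i. module R (D i)"
    and d: "\<And>i. d i \<in> mod_hom R (C (Suc i)) (C i)"
    and e: "\<And>i. e i \<in> mod_hom R (D (Suc i)) (D i)"
    and complex: "\<And>i. d i ` carrier (C (Suc i)) \<subseteq> cycles C d Z i"
    and exact: "\<And>i. cycles D e W i \<subseteq> e i ` carrier (D (Suc i))"
    and lift: "\<And>i u. u \<in> mod_hom R (C (Suc i)) (D i) \<Longrightarrow>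
      u ` carrier (C (Suc i)) \<subseteq> e i ` carrier (D (Suc i)) \<Longrightarrow>
      \<exists>h\<in>mod_hom R (C (Suc i)) (D (Suc i)). \<forall>x\<in>carrier (C (Suc i)). e i (h x) = u x"
  shows "\<exists>\<phi>. \<phi> 0 = \<phi>0 \<and> (\<forall>i. \<phi> i \<in> mod_hom R (C i) (D i)) \<and>
    (\<forall>i. \<forall>x\<in>carrier (C (Suc i)). e i (\<phi> (Suc i) x) = \<phi> i (d i x))"
proof -
  \<comment> \<open>Preservation of cycles is carried along: with exactness of the target it puts
    \<open>f \<circ> d i\<close> into the image of \<open>e i\<close>, so the next map
    exists.\<close>
  let ?P = "\<lambda>i f. f \<in> mod_hom R (C i) (D i) \<and> f ` cycles C d Z i \<subseteq> cycles D e W i \<and>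
    (i = 0 \<longrightarrow> f = \<phi>0)"
  let ?Q = "\<lambda>i f f'. \<forall>x\<in>carrier (C (Suc i)). e i (f' x) = f (d i x)"
  have "\<exists>f. \<forall>i. ?P i (f i) \<and> ?Q i (f i) (f (Suc i))"
  proof (rule dependent_nat_choice)
    show "\<exists>f. ?P 0 f"
      using \<phi>0 by (auto simp: cycles_simps)
    fix f i
    assume f: "?P i f"
    then have "(\<lambda>x. f (d i x)) \<in> mod_hom R (C (Suc i)) (D i)"
      using mod_hom_comp[OF d] by blast
    moreover have "(\<lambda>x. f (d i x)) ` carrier (C (Suc i)) \<subseteq> e i ` carrier (D (Suc i))"
      using f complex[of i] exact[of i] by blast
    ultimately obtain h where h: "h \<in> mod_hom R (C (Suc i)) (D (Suc i))"
      and eh: "\<forall>x\<in>carrier (C (Suc i)). e i (h x) = f (d i x)"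
      using lift by meson
    have "h ` cycles C d Z (Suc i) \<subseteq> cycles D e W (Suc i)"
      using h eh mod_hom_zero[OF C D] f by (auto simp: cycles_simps mod_homD(1))
    then show "\<exists>f'. ?P (Suc i) f' \<and> ?Q i f f'"
      using h eh by blast
  qed
  then show ?thesis by blast
qed

text \<open>
  Bases are sets of natural numbers, so the direct sum of two free modules is realised on the even
  and the odd numbers.
\<close>
definition interleave :: "(nat \<Rightarrow> 'a) \<Rightarrow> (nat \<Rightarrow> 'a) \<Rightarrow> nat \<Rightarrow> 'a" where
  "interleave v w j = (if even j then v (j div 2) else w (j div 2))"

lemma interleave_simps [simp]:
  "interleave v w (2 * j) = v j" "interleave v w (Suc (2 * j)) = w j"
  by (simp_all add: interleave_def)

lemma interleave_collapse: "interleave (\<lambda>j. u (2 * j)) (\<lambda>j. u (Suc (2 * j))) = u"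
  by (rule ext) (auto simp: interleave_def odd_two_times_div_two_succ elim: evenE)

lemma interleave_eq_iff: "interleave v w = interleave v' w' \<longleftrightarrow> v = v' \<and> w = w'"
proof
  assume eq: "interleave v w = interleave v' w'"
  have "v j = v' j" "w j = w' j" for j
    using fun_cong[OF eq, of "2 * j"] fun_cong[OF eq, of "Suc (2 * j)"] by auto
  then show "v = v' \<and> w = w'" by auto
qed simp

definition interleave_sets :: "nat set \<Rightarrow> nat set \<Rightarrow> nat set" where
  "interleave_sets A B = (\<lambda>j. 2 * j) ` A \<union> (\<lambda>j. Suc (2 * j)) ` B"

lemma mem_interleave_sets [simp]:
  "2 * j \<in> interleave_sets A B \<longleftrightarrow> j \<in> A"
  "Suc (2 * j) \<in> interleave_sets A B \<longleftrightarrow> j \<in> B"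
  by (auto simp: interleave_sets_def) presburger+

lemma all_nat_parity: "(\<forall>j. P j) \<longleftrightarrow> (\<forall>j. P (2 * j)) \<and> (\<forall>j. P (Suc (2 * j)))"
  by (metis evenE oddE Suc_eq_plus1)

context unital_subring
begin

lemma interleave_mem_free [simp]:
  "interleave v w \<in> carrier (Fr (interleave_sets A B)) \<longleftrightarrow>
    v \<in> carrier (Fr A) \<and> w \<in> carrier (Fr B)"
  by (subst free_simps, subst mem_Collect_eq, subst all_nat_parity, subst (2) all_nat_parity)
    auto

section \<open>Linear maps between free modules\<close>

lemma free_hom_simps:
  assumes h: "h \<in> mod_hom R (Fr A) (Fr B)" and v: "v \<in> carrier (Fr A)"
  shows "h v \<in> carrier (Fr B)" "h v j \<in> S" "j \<notin> B \<Longrightarrow> h v j = 0"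
    "w \<in> carrier (Fr A) \<Longrightarrow> h (\<lambda>j. v j + w j) = (\<lambda>j. h v j + h w j)"
    "w \<in> carrier (Fr A) \<Longrightarrow> h (\<lambda>j. v j - w j) = (\<lambda>j. h v j - h w j)"
    "r \<in> S \<Longrightarrow> h (\<lambda>j. r * v j) = (\<lambda>j. r * h v j)"
    "h (\<lambda>j. - v j) = (\<lambda>j. - h v j)"
proof -
  show *: "h v \<in> carrier (Fr B)"
    by (rule mod_homD(1)[OF h v])
  then show "h v j \<in> S" and "j \<notin> B \<Longrightarrow> h v j = 0" by auto
  show add: "h (\<lambda>j. v j + w j) = (\<lambda>j. h v j + h w j)" if "w \<in> carrier (Fr A)" for w
    using mod_homD(2)[OF h v that] by simp
  have smult: "h (\<lambda>j. r * x j) = (\<lambda>j. r * h x j)" if "x \<in> carrier (Fr A)" "r \<in> S" for r x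
    using mod_homD(3)[OF h, of r x] that by simp
  show "r \<in> S \<Longrightarrow> h (\<lambda>j. r * v j) = (\<lambda>j. r * h v j)"
    using smult v by simp
  have minus: "h (\<lambda>j. - x j) = (\<lambda>j. - h x j)" if "x \<in> carrier (Fr A)" for x
    using smult[OF that, of "- 1"] by simp
  show "h (\<lambda>j. - v j) = (\<lambda>j. - h v j)"
    using minus v by simp
  show "h (\<lambda>j. v j - w j) = (\<lambda>j. h v j - h w j)" if "w \<in> carrier (Fr A)"
    using add[of "\<lambda>j. - w j"] minus[OF that] that by auto
qed

lemma free_hom_zero [simp]:
  assumes "h \<in> mod_hom R (Fr A) (Fr B)"
  shows "h (\<lambda>_. 0) = (\<lambda>_. 0)"
  using mod_hom_zero[OF module_free module_free assms] by simp

lemma free_homI: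
  assumes "\<And>v. v \<in> carrier (Fr A) \<Longrightarrow> h v \<in> carrier (Fr B)"
    and "\<And>v w. v \<in> carrier (Fr A) \<Longrightarrow> w \<in> carrier (Fr A) \<Longrightarrow>
      h (\<lambda>j. v j + w j) = (\<lambda>j. h v j + h w j)"
    and "\<And>r v. r \<in> S \<Longrightarrow> v \<in> carrier (Fr A) \<Longrightarrow> h (\<lambda>j. r * v j) = (\<lambda>j. r * h v j)"
  shows "h \<in> mod_hom R (Fr A) (Fr B)"
  using assms by (intro mod_homI) auto

lemma free_hom_diff:
  assumes f: "f \<in> mod_hom R (Fr A) (Fr B)" and g: "g \<in> mod_hom R (Fr A) (Fr B)"
  shows "(\<lambda>v j. f v j - g v j) \<in> mod_hom R (Fr A) (Fr B)"
proof (rule free_homI)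
  show "(\<lambda>j. f v j - g v j) \<in> carrier (Fr B)" if v: "v \<in> carrier (Fr A)" for v
    using free_hom_simps(2,3)[OF f v] free_hom_simps(2,3)[OF g v] by simp
qed (simp_all add: free_hom_simps[OF f] free_hom_simps[OF g] algebra_simps del: free_simps)

text \<open>A resolution of the cyclic module \<open>S/J\<close> by finite free modules. The
  augmentation is left implicit: degree 0 has rank one, and the kernel of its map to
  \<open>S/J\<close> consists of the vectors with \<open>v 0 \<in> J\<close>.\<close>

definition free_resolution :: "'r set \<Rightarrow> (nat \<Rightarrow> nat set) \<Rightarrow> (nat \<Rightarrow> (nat \<Rightarrow> 'r) \<Rightarrow> nat \<Rightarrow> 'r) \<Rightarrow> bool"
  where
  "free_resolution J B d \<longleftrightarrow> (\<forall>i. finite (B i)) \<and> B 0 = {0} \<and>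
    (\<forall>i. d i \<in> mod_hom R (Fr (B (Suc i))) (Fr (B i))) \<and>
    (\<forall>i. d i ` carrier (Fr (B (Suc i))) =
      cycles (\<lambda>i. Fr (B i)) d {v \<in> carrier (Fr (B 0)). v 0 \<in> J} i)"

lemma free_resolutionD:
  assumes "free_resolution J B d"
  shows "finite (B i)" "B 0 = {0}" "d i \<in> mod_hom R (Fr (B (Suc i))) (Fr (B i))"
    "d i ` carrier (Fr (B (Suc i))) =
      cycles (\<lambda>i. Fr (B i)) d {v \<in> carrier (Fr (B 0)). v 0 \<in> J} i"
  using assms by (simp_all add: free_resolution_def)

lemma free_resolution_comp:
  assumes "free_resolution J B d" and "v \<in> carrier (Fr (B (Suc (Suc i))))"
  shows "d i (d (Suc i) v) = (\<lambda>_. 0)"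
proof -
  have "d (Suc i) v \<in> d (Suc i) ` carrier (Fr (B (Suc (Suc i))))"
    using assms(2) by blast
  then show ?thesis
    using free_resolutionD(4)[OF assms(1), of "Suc i"] by (simp add: cycles_simps)
qed

text \<open>By \<gamma>0 the chain map \<gamma> covers the zero map of \<open>S/J\<close>. The
  homotopy is built degree by degree, since \<open>\<gamma> (Suc i) - h i \<circ> d i\<close> takes
  values in the cycles and lifts through \<open>d (Suc i)\<close>.\<close>

lemma homotopy_exists:
  assumes res: "free_resolution J B d"
    and \<gamma>: "\<And>i. \<gamma> i \<in> mod_hom R (Fr (B i)) (Fr (B i))"
    and \<gamma>0: "\<And>v. v \<in> carrier (Fr (B 0)) \<Longrightarrow> \<gamma> 0 v 0 \<in> J"
    and comm: "\<And>i v. v \<in> carrier (Fr (B (Suc i))) \<Longrightarrow> d i (\<gamma> (Suc i) v) = \<gamma> i (d i v)"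
  shows "\<exists>h. (\<forall>i. h i \<in> mod_hom R (Fr (B i)) (Fr (B (Suc i)))) \<and>
    (\<forall>i. \<forall>v\<in>carrier (Fr (B (Suc i))).
      d (Suc i) (h (Suc i) v) = (\<lambda>j. \<gamma> (Suc i) v j - h i (d i v) j))"
proof -
  note d = free_resolutionD(3)[OF res]
  \<comment> \<open>Agreement of \<open>d i \<circ> h\<close> with \<open>\<gamma> i\<close> on
    boundaries is what makes the next map to be lifted land in the cycles; it reads the same in
    degree 0 and above.\<close>
  let ?P = "\<lambda>i h. h \<in> mod_hom R (Fr (B i)) (Fr (B (Suc i))) \<and>
    (\<forall>v\<in>carrier (Fr (B (Suc i))). d i (h (d i v)) = \<gamma> i (d i v))"
  let ?Q = "\<lambda>i h h'. \<forall>v\<in>carrier (Fr (B (Suc i))).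
    d (Suc i) (h' v) = (\<lambda>j. \<gamma> (Suc i) v j - h (d i v) j)"
  have "\<exists>h. \<forall>i. ?P i (h i) \<and> ?Q i (h i) (h (Suc i))"
  proof (rule dependent_nat_choice)
    have "\<gamma> 0 ` carrier (Fr (B 0)) \<subseteq> d 0 ` carrier (Fr (B (Suc 0)))"
      unfolding free_resolutionD(4)[OF res] cycles_simps
      using mod_homD(1)[OF \<gamma>] \<gamma>0 by blast
    then obtain h where "h \<in> mod_hom R (Fr (B 0)) (Fr (B (Suc 0)))"
      "\<forall>v\<in>carrier (Fr (B 0)). d 0 (h v) = \<gamma> 0 v"
      using free_lift[OF free_resolutionD(1)[OF res] module_free module_free d \<gamma>] by blast
    then have "?P 0 h"
      using mod_homD(1)[OF d] by blast
    then show "\<exists>h. ?P 0 h" by blast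
    fix h i
    assume h: "?P i h"
    let ?u = "\<lambda>v j. \<gamma> (Suc i) v j - h (d i v) j"
    have hd: "(\<lambda>v. h (d i v)) \<in> mod_hom R (Fr (B (Suc i))) (Fr (B (Suc i)))"
      using h mod_hom_comp[OF d] by blast
    have u: "?u \<in> mod_hom R (Fr (B (Suc i))) (Fr (B (Suc i)))"
      by (rule free_hom_diff[OF \<gamma> hd])
    have "d i (?u v) = (\<lambda>_. 0)" if v: "v \<in> carrier (Fr (B (Suc i)))" for v
    proof -
      have "d i (?u v) = (\<lambda>j. d i (\<gamma> (Suc i) v) j - d i (h (d i v)) j)"
        by (rule free_hom_simps(5)[OF d mod_homD(1)[OF \<gamma> v] mod_homD(1)[OF hd v]])
      then show ?thesis
        using h comm v by simp
    qed
    then have "?u ` carrier (Fr (B (Suc i))) \<subseteq> d (Suc i) ` carrier (Fr (B (Suc (Suc i))))"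
      unfolding free_resolutionD(4)[OF res] cycles_simps
      using mod_homD(1)[OF u] by auto
    then obtain h' where h': "h' \<in> mod_hom R (Fr (B (Suc i))) (Fr (B (Suc (Suc i))))"
      "\<forall>v\<in>carrier (Fr (B (Suc i))). d (Suc i) (h' v) = ?u v"
      using free_lift[OF free_resolutionD(1)[OF res] module_free module_free d u] by blast
    have "d (Suc i) (h' (d (Suc i) v)) = \<gamma> (Suc i) (d (Suc i) v)"
      if v: "v \<in> carrier (Fr (B (Suc (Suc i))))" for v
    proof -
      have "h (d i (d (Suc i) v)) = (\<lambda>_. 0)"
        using free_resolution_comp[OF res v] free_hom_zero h by metis
      then show ?thesis
        using h'(2) mod_homD(1)[OF d v] by simp
    qed
    then show "\<exists>h'. ?P (Suc i) h' \<and> ?Q i h h'"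
      using h' by blast
  qed
  then show ?thesis by blast
qed

end

section \<open>Minimal free resolutions and mapping cones\<close>

text \<open>Minimality is measured against \<open>\<mm>\<close>, which is closed under addition and
  multiplication by \<open>S\<close> and misses 1. The instance is the set of polynomials without
  constant term.\<close>

locale unital_subring_ideal = unital_subring S for S :: "'r::comm_ring_1 set" +
  fixes \<mm> :: "'r set"
  assumes ideal_zero [simp]: "0 \<in> \<mm>" and one_notin_ideal: "1 \<notin> \<mm>"
    and ideal_add [simp]: "a \<in> \<mm> \<Longrightarrow> b \<in> \<mm> \<Longrightarrow> a + b \<in> \<mm>"
    and ideal_mult [simp]: "a \<in> S \<Longrightarrow> b \<in> \<mm> \<Longrightarrow> a * b \<in> \<mm>"
begin

lemma ideal_uminus [simp]: "a \<in> \<mm> \<Longrightarrow> - a \<in> \<mm>"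
  using ideal_mult[of "- 1" a] by simp

text \<open>Expanded in the basis, \<open>h v\<close> is a combination of values of \<open>h\<close>
  with coefficients \<open>v b\<close> in \<open>\<mm>\<close>. This ends the minimality argument,
  where a homotopy is applied to a boundary.\<close>

lemma free_hom_ideal:
  assumes "finite A" and "h \<in> mod_hom R (Fr A) (Fr B)"
    and "v \<in> carrier (Fr A)" and "\<And>j. v j \<in> \<mm>"
  shows "h v j \<in> \<mm>"
  using assms
proof (induction A arbitrary: v)
  case empty
  then have "v = (\<lambda>_. 0)" by auto
  then show ?case
    using free_hom_zero[OF empty(1)] by simp
next
  case (insert b A)
  note h = insert.prems(1)
  define e :: "nat \<Rightarrow> 'r" where "e = (\<lambda>j. if j = b then 1 else 0)"
  have h': "h \<in> mod_hom R (Fr A) (Fr B)"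
    using h by (auto simp: mod_hom_def)
  have e: "e \<in> carrier (Fr (insert b A))" and v': "v(b := 0) \<in> carrier (Fr A)"
    and v'': "v(b := 0) \<in> carrier (Fr (insert b A))" and vb: "v b \<in> S"
    using insert.prems(2) by (auto simp: e_def)
  have be: "(\<lambda>j. v b * e j) \<in> carrier (Fr (insert b A))"
    using e vb by auto
  have "v = (\<lambda>j. (v(b := 0)) j + v b * e j)"
    by (auto simp: e_def)
  then have "h v = h (\<lambda>j. (v(b := 0)) j + v b * e j)" by simp
  also have "\<dots> = (\<lambda>j. h (v(b := 0)) j + v b * h e j)"
    unfolding free_hom_simps(4)[OF h v'' be] free_hom_simps(6)[OF h e vb] ..
  finally have "h v j = h (v(b := 0)) j + h e j * v b"
    by (simp add: mult.commute)
  moreover have "h (v(b := 0)) j \<in> \<mm>"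
    using insert.prems(3) by (intro insert.IH h' v') simp
  ultimately show ?case
    using insert.prems(3) free_hom_simps(2)[OF h e] by simp
qed

definition minimal_diff :: "(nat \<Rightarrow> nat set) \<Rightarrow> (nat \<Rightarrow> (nat \<Rightarrow> 'r) \<Rightarrow> nat \<Rightarrow> 'r) \<Rightarrow> bool" where
  "minimal_diff B d \<longleftrightarrow> (\<forall>i. \<forall>v\<in>carrier (Fr (B (Suc i))). \<forall>j. d i v j \<in> \<mm>)"

text \<open>\<open>B f \<noteq> {}\<close> makes \<open>f\<close> the exact length, which minimality
  turns into the projective dimension.\<close>

definition has_min_res :: "'r set \<Rightarrow> nat \<Rightarrow> bool" where
  "has_min_res J f \<longleftrightarrow> (\<exists>B d. free_resolution J B d \<and> minimal_diff B d \<and> B f \<noteq> {} \<and> (\<forall>i>f. B i = {}))"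

text \<open>\<open>S\<close> resolves itself; all path ideals are reached from here by
  cones.\<close>

lemma has_min_res_zero: "has_min_res {0} 0"
proof -
  define B :: "nat \<Rightarrow> nat set" where "B i = (if i = 0 then {0} else {})" for i
  define d :: "nat \<Rightarrow> (nat \<Rightarrow> 'r) \<Rightarrow> nat \<Rightarrow> 'r" where "d = (\<lambda>_ _ _. 0)"
  have "d i \<in> mod_hom R (Fr (B (Suc i))) (Fr (B i))" for i
    by (rule free_homI) (auto simp: d_def)
  moreover have "d i ` carrier (Fr (B (Suc i))) =
      cycles (\<lambda>i. Fr (B i)) d {v \<in> carrier (Fr (B 0)). v 0 \<in> {0}} i" for i
  proof -
    have "d i ` carrier (Fr (B (Suc i))) = {\<lambda>_. 0}"
      by (auto simp: d_def B_def image_iff intro!: exI[of _ "\<lambda>_. 0"])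
    moreover have "cycles (\<lambda>i. Fr (B i)) d {v \<in> carrier (Fr (B 0)). v 0 \<in> {0}} i = {\<lambda>_. 0}"
      by (cases i) (auto simp: cycles_simps B_def d_def fun_eq_iff, metis gr0I)
    ultimately show ?thesis by simp
  qed
  ultimately have "free_resolution {0} B d"
    by (simp add: free_resolution_def B_def)
  moreover have "minimal_diff B d"
    by (simp add: minimal_diff_def d_def)
  ultimately show ?thesis
    unfolding has_min_res_def by (intro exI[of _ B] exI[of _ d]) (simp add: B_def)
qed

text \<open>
  The mapping cone of multiplication by \<open>m = y * m'\<close> from \<open>S/(J : m)\<close> to \<open>S/J\<close>. Multiplication by \<open>m'\<close>
  is already well defined between these quotients, so the chain map can be chosen divisible by
  \<open>y \<in> \<mm>\<close>, which keeps the cone minimal.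
\<close>
lemma has_min_res_cone:
  assumes J: "has_min_res J a" and K: "has_min_res K b" and ab: "a \<le> Suc b"
    and J_sub: "J \<subseteq> S"
    and J_mult: "\<And>u v. u \<in> S \<Longrightarrow> v \<in> J \<Longrightarrow> u * v \<in> J"
    and y: "y \<in> \<mm>" "y \<in> S" and m': "m' \<in> S"
    and colon: "\<And>r. r \<in> S \<Longrightarrow> r * (y * m') \<in> J \<longleftrightarrow> r \<in> K"
    and factor: "\<And>r. r \<in> K \<Longrightarrow> r * m' \<in> J"
  shows "has_min_res {u + r * (y * m') | u r. u \<in> J \<and> r \<in> S} (Suc b)"
proof -
  let ?J' = "{u + r * (y * m') | u r. u \<in> J \<and> r \<in> S}"
  obtain G d where G: "free_resolution J G d" and Gmin: "minimal_diff G d"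
    and Gtop: "\<forall>i>a. G i = {}"
    using J unfolding has_min_res_def by blast
  obtain F c where F: "free_resolution K F c" and Fmin: "minimal_diff F c"
    and Ftop: "F b \<noteq> {}" "\<forall>i>b. F i = {}"
    using K unfolding has_min_res_def by blast
  note d = free_resolutionD(3)[OF G] and c = free_resolutionD(3)[OF F]
  let ?ZG = "cycles (\<lambda>i. Fr (G i)) d {v \<in> carrier (Fr (G 0)). v 0 \<in> J}"
  let ?ZF = "cycles (\<lambda>i. Fr (F i)) c {v \<in> carrier (Fr (F 0)). v 0 \<in> K}"
  have F0: "F 0 = {0}" and G0: "G 0 = {0}"
    using F G by (auto simp: free_resolution_def)
  \<comment> \<open>\<open>factor\<close> says that multiplication by \<open>m'\<close> sends
    \<open>K\<close> into \<open>J\<close>. \<phi> lifts it, so \<open>y * \<phi>\<close> lifts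
    multiplication by \<open>y * m'\<close>.\<close>
  obtain \<phi> where \<phi>0: "\<phi> 0 = (\<lambda>v j. m' * v j)"
    and \<phi>: "\<And>i. \<phi> i \<in> mod_hom R (Fr (F i)) (Fr (G i))"
    and \<phi>_comm: "\<And>i v. v \<in> carrier (Fr (F (Suc i))) \<Longrightarrow> d i (\<phi> (Suc i) v) = \<phi> i (c i v)"
  proof -
    have "\<exists>\<phi>. \<phi> 0 = (\<lambda>v j. m' * v j) \<and> (\<forall>i. \<phi> i \<in> mod_hom R (Fr (F i)) (Fr (G i))) \<and>
      (\<forall>i. \<forall>v\<in>carrier (Fr (F (Suc i))). d i (\<phi> (Suc i) v) = \<phi> i (c i v))"
    proof (rule chain_map_exists[where Z = "{v \<in> carrier (Fr (F 0)). v 0 \<in> K}"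
          and W = "{v \<in> carrier (Fr (G 0)). v 0 \<in> J}"])
      show "(\<lambda>v j. m' * v j) \<in> mod_hom R (Fr (F 0)) (Fr (G 0))"
        by (rule free_homI) (auto simp: F0 G0 m' algebra_simps)
      show "(\<lambda>v j. m' * v j) ` {v \<in> carrier (Fr (F 0)). v 0 \<in> K} \<subseteq> {v \<in> carrier (Fr (G 0)). v 0 \<in> J}"
        using factor by (auto simp: F0 G0 m' mult.commute[of m'])
      show "\<exists>h\<in>mod_hom R (Fr (F (Suc i))) (Fr (G (Suc i))). \<forall>x\<in>carrier (Fr (F (Suc i))). d i (h x) = u x"
        if "u \<in> mod_hom R (Fr (F (Suc i))) (Fr (G i))"
          "u ` carrier (Fr (F (Suc i))) \<subseteq> d i ` carrier (Fr (G (Suc i)))" for i u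
        by (rule free_lift[OF free_resolutionD(1)[OF F] module_free module_free d that])
    qed (use module_free d c free_resolutionD(4)[OF F] free_resolutionD(4)[OF G] in simp_all)
    then show ?thesis using that by blast
  qed
  \<comment> \<open>Degree \<open>i\<close> of the cone is \<open>G i\<close> plus
    \<open>F (i - 1)\<close>, on even and odd indices respectively.\<close>
  define H where "H i = interleave_sets (G i) (case i of 0 \<Rightarrow> {} | Suc k \<Rightarrow> F k)" for i
  have H0: "H 0 = {0}" and HS: "H (Suc i) = interleave_sets (G (Suc i)) (F i)" for i
    by (simp_all add: H_def G0 interleave_sets_def)
  \<comment> \<open>A pair \<open>(g, f)\<close> goes to \<open>(d g + y \<phi> f, - c f)\<close>;
    the sign makes the square vanish. For \<open>i = 0\<close> the target has no \<open>F\<close>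
    part.\<close>
  define \<delta> where "\<delta> i u = interleave
      (\<lambda>j. d i (\<lambda>j. u (2 * j)) j + y * \<phi> i (\<lambda>j. u (Suc (2 * j))) j)
      (case i of 0 \<Rightarrow> \<lambda>_. 0 | Suc k \<Rightarrow> \<lambda>j. - c k (\<lambda>j. u (Suc (2 * j))) j)" for i u
  have \<delta>0: "\<delta> 0 (interleave g f) = interleave (\<lambda>j. d 0 g j + y * \<phi> 0 f j) (\<lambda>_. 0)"
    and \<delta>S: "\<delta> (Suc i) (interleave g f) =
      interleave (\<lambda>j. d (Suc i) g j + y * \<phi> (Suc i) f j) (\<lambda>j. - c i f j)" for i g f
    by (simp_all add: \<delta>_def)
  have split: "\<exists>g\<in>carrier (Fr (G (Suc i))). \<exists>f\<in>carrier (Fr (F i)). u = interleave g f"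
    if "u \<in> carrier (Fr (H (Suc i)))" for u i
  proof -
    have "interleave (\<lambda>j. u (2 * j)) (\<lambda>j. u (Suc (2 * j))) \<in> carrier (Fr (H (Suc i)))"
      using that by (simp only: interleave_collapse)
    then show ?thesis
      unfolding HS interleave_mem_free by (metis interleave_collapse)
  qed
  have mem: "interleave g f \<in> carrier (Fr (H (Suc i)))"
    if "g \<in> carrier (Fr (G (Suc i)))" "f \<in> carrier (Fr (F i))" for g f i
    using that unfolding HS interleave_mem_free by simp
  have top: "(\<lambda>j. d i g j + y * \<phi> i f j) \<in> carrier (Fr (G i))"
    if "g \<in> carrier (Fr (G (Suc i)))" "f \<in> carrier (Fr (F i))" for g f i
    using free_hom_simps(2,3)[OF d that(1)] free_hom_simps(2,3)[OF \<phi> that(2)] y(2) by simp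
  have bot: "(\<lambda>j. - c i f j) \<in> carrier (Fr (F i))" if "f \<in> carrier (Fr (F (Suc i)))" for f i
    using free_hom_simps(2,3)[OF c that] by simp
  have even_hom: "(\<lambda>j. u (2 * j)) \<in> carrier (Fr (G (Suc i)))"
    and odd_hom: "(\<lambda>j. u (Suc (2 * j))) \<in> carrier (Fr (F i))"
    if "u \<in> carrier (Fr (H (Suc i)))" for u i
    using that by (auto simp: HS)
  have \<delta>_hom: "\<delta> i \<in> mod_hom R (Fr (H (Suc i))) (Fr (H i))" for i
  proof (rule free_homI)
    fix u assume u: "u \<in> carrier (Fr (H (Suc i)))"
    note uG = even_hom[OF u] and uF = odd_hom[OF u]
    show "\<delta> i u \<in> carrier (Fr (H i))"
    proof (cases i)
      case 0
      then show ?thesis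
        unfolding H_def \<delta>_def interleave_mem_free using top[OF uG uF] by simp
    next
      case (Suc k)
      then show ?thesis
        unfolding H_def \<delta>_def interleave_mem_free
        using top[OF uG uF] bot[OF uF[unfolded Suc]] by simp
    qed
    show "\<delta> i (\<lambda>j. r * u j) = (\<lambda>j. r * \<delta> i u j)" if r: "r \<in> S" for r
      unfolding \<delta>_def free_hom_simps(6)[OF d uG r] free_hom_simps(6)[OF \<phi> uF r]
      using free_hom_simps(6)[OF c _ r] uF
      by (auto simp: interleave_def algebra_simps fun_eq_iff split: nat.split simp del: free_simps)
    fix w assume w: "w \<in> carrier (Fr (H (Suc i)))"
    note wG = even_hom[OF w] and wF = odd_hom[OF w]
    show "\<delta> i (\<lambda>j. u j + w j) = (\<lambda>j. \<delta> i u j + \<delta> i w j)"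
      unfolding \<delta>_def free_hom_simps(4)[OF d uG wG] free_hom_simps(4)[OF \<phi> uF wF]
      using free_hom_simps(4)[OF c] uF wF
      by (auto simp: interleave_def algebra_simps fun_eq_iff split: nat.split simp del: free_simps)
  qed
  let ?ZH = "cycles (\<lambda>i. Fr (H i)) \<delta> {v \<in> carrier (Fr (H 0)). v 0 \<in> ?J'}"
  have exact: "\<delta> i ` carrier (Fr (H (Suc i))) = ?ZH i" for i
  proof (cases i)
    case 0
    \<comment> \<open>In degree 0 the image consists of the values
      \<open>d 0 g 0 + f 0 * (y * m')\<close>, where the first summand runs through \<open>J\<close>
      and \<open>f 0\<close> through \<open>S\<close>.\<close>
    have "u \<in> ?ZH 0" if u_in: "u \<in> \<delta> 0 ` carrier (Fr (H (Suc 0)))" for u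
    proof -
      obtain g f where g: "g \<in> carrier (Fr (G (Suc 0)))" and f: "f \<in> carrier (Fr (F 0))"
        and u: "u = \<delta> 0 (interleave g f)"
        using u_in split by blast
      have "d 0 g \<in> ?ZG 0"
        using g free_resolutionD(4)[OF G] by blast
      then have "d 0 g 0 \<in> J" by (simp add: cycles_simps)
      moreover have "u 0 = d 0 g 0 + f 0 * (y * m')"
        using interleave_simps(1)[of _ _ 0] by (simp add: u \<delta>0 \<phi>0 algebra_simps)
      moreover have "u \<in> carrier (Fr (H 0))"
        unfolding u by (rule mod_homD(1)[OF \<delta>_hom mem[OF g f]])
      moreover have "f 0 \<in> S"
        using f by simp
      ultimately show ?thesis
        unfolding cycles_simps by blast
    qed
    moreover have "u \<in> \<delta> 0 ` carrier (Fr (H (Suc 0)))" if u_in: "u \<in> ?ZH 0" for u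
    proof -
      obtain k r where k: "k \<in> J" and r: "r \<in> S" and u0: "u 0 = k + r * (y * m')"
        and u: "u \<in> carrier (Fr {0})"
        using u_in by (auto simp: cycles_simps H0)
      have "(\<lambda>j. if j = 0 then k else 0) \<in> ?ZG 0"
        using k J_sub by (auto simp: cycles_simps G0)
      then obtain g where g: "g \<in> carrier (Fr (G (Suc 0)))" "d 0 g = (\<lambda>j. if j = 0 then k else 0)"
        using free_resolutionD(4)[OF G, of 0] by (metis (no_types, lifting) imageE)
      let ?f = "\<lambda>j::nat. if j = 0 then r else 0"
      have f: "?f \<in> carrier (Fr (F 0))"
        using r by (simp add: F0)
      have "\<delta> 0 (interleave g ?f) = u"
        unfolding \<delta>0 g(2) \<phi>0 using u u0 by (auto simp: interleave_def fun_eq_iff algebra_simps)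
      then show ?thesis
        using mem[OF g(1) f] by blast
    qed
    ultimately show ?thesis
      unfolding 0 by blast
  next
    case (Suc n)
    have "u \<in> ?ZH (Suc n)" if u_in: "u \<in> \<delta> (Suc n) ` carrier (Fr (H (Suc (Suc n))))" for u
    proof -
      obtain g f where g: "g \<in> carrier (Fr (G (Suc (Suc n))))" and f: "f \<in> carrier (Fr (F (Suc n)))"
        and u: "u = \<delta> (Suc n) (interleave g f)"
        using u_in split by blast
      note cf = mod_homD(1)[OF c f] and dg = mod_homD(1)[OF d g] and \<phi>f = mod_homD(1)[OF \<phi> f]
      have y\<phi>: "(\<lambda>j. y * \<phi> (Suc n) f j) \<in> carrier (Fr (G (Suc n)))"
        using \<phi>f y(2) by simp
      \<comment> \<open>\<open>d \<circ> d\<close> kills \<open>g\<close>; the remaining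
        \<open>y \<phi> (c f)\<close> cancels against what \<delta> makes of the second component
        \<open>- c f\<close>.\<close>
      have "d n (\<lambda>j. d (Suc n) g j + y * \<phi> (Suc n) f j) = (\<lambda>j. y * \<phi> n (c n f) j)"
        unfolding free_hom_simps(4)[OF d dg y\<phi>] free_hom_simps(6)[OF d \<phi>f y(2)]
          free_resolution_comp[OF G g] \<phi>_comm[OF f] by simp
      moreover have "\<phi> n (\<lambda>j. - c n f j) = (\<lambda>j. - \<phi> n (c n f) j)"
        by (rule free_hom_simps(7)[OF \<phi> cf])
      moreover have "c k (\<lambda>j. - c n f j) = (\<lambda>_. 0)" if "n = Suc k" for k
        using free_hom_simps(7)[OF c[of k] cf[unfolded that]] free_resolution_comp[OF F f[unfolded that]]
        by (simp add: that)
      ultimately have "\<delta> n u = (\<lambda>_. 0)"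
        unfolding u \<delta>S by (cases n) (auto simp: \<delta>0 \<delta>S interleave_def)
      moreover have "u \<in> carrier (Fr (H (Suc n)))"
        unfolding u by (rule mod_homD(1)[OF \<delta>_hom mem[OF g f]])
      ultimately show ?thesis by (simp add: cycles_simps)
    qed
    moreover have "u \<in> \<delta> (Suc n) ` carrier (Fr (H (Suc (Suc n))))" if u_in: "u \<in> ?ZH (Suc n)" for u
    proof -
      have "u \<in> carrier (Fr (H (Suc n)))" and \<delta>u: "\<delta> n u = (\<lambda>_. 0)"
        using u_in by (simp_all add: cycles_simps)
      then obtain g f where g: "g \<in> carrier (Fr (G (Suc n)))" and f: "f \<in> carrier (Fr (F n))"
        and u: "u = interleave g f"
        using split by blast
      have "(\<lambda>_. 0) = interleave (\<lambda>_. 0) (\<lambda>_. 0 :: 'r)"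
        by (auto simp: interleave_def)
      then have \<delta>0u: "\<delta> n (interleave g f) = interleave (\<lambda>_. 0) (\<lambda>_. 0)"
        using \<delta>u u by simp
      have gf: "(\<lambda>j. d n g j + y * \<phi> n f j) = (\<lambda>_. 0)"
        using \<delta>0u by (cases n) (simp_all only: \<delta>0 \<delta>S interleave_eq_iff)
      \<comment> \<open>The second component of a cycle is a cycle of \<open>F\<close>. In degree 0
        this is \<open>colon\<close>, because \<open>f 0 * (y * m')\<close> is the negative of an
        element of \<open>J\<close>.\<close>
      have "f \<in> ?ZF n"
      proof (cases n)
        case 0
        have "d 0 g \<in> ?ZG 0"
          using g free_resolutionD(4)[OF G] unfolding 0 by blast
        then have "d 0 g 0 \<in> J" by (simp add: cycles_simps)
        moreover have "d 0 g 0 + f 0 * (y * m') = 0"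
          using fun_cong[OF gf, of 0] by (simp add: 0 \<phi>0 algebra_simps)
        then have "f 0 * (y * m') = (- 1) * d 0 g 0"
          by (simp add: eq_neg_iff_add_eq_0 add.commute)
        ultimately have "f 0 * (y * m') \<in> J"
          using J_mult[of "- 1"] by simp
        then show ?thesis
          using f colon[of "f 0"] by (auto simp: cycles_simps 0)
      next
        case (Suc k)
        have "(\<lambda>j. - c k f j) = (\<lambda>_. 0)"
          using \<delta>0u unfolding Suc \<delta>S interleave_eq_iff by simp
        then show ?thesis
          using f unfolding Suc by (simp add: cycles_simps fun_eq_iff)
      qed
      then obtain x where x: "x \<in> carrier (Fr (F (Suc n)))" and fx: "f = c n x"
        using free_resolutionD(4)[OF F, of n] by (metis (no_types, lifting) imageE)
      note \<phi>x = mod_homD(1)[OF \<phi> x]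
      have y\<phi>: "(\<lambda>j. y * \<phi> (Suc n) x j) \<in> carrier (Fr (G (Suc n)))"
        using \<phi>x y(2) by simp
      \<comment> \<open>With \<open>f = c n x\<close>, adding \<open>y \<phi> x\<close> to
        \<open>g\<close> gives a cycle of \<open>G\<close>, hence a boundary \<open>d g'\<close>;
        then \<delta> sends \<open>(g', - x)\<close> to \<open>(g, f)\<close>.\<close>
      let ?g = "\<lambda>j. g j + y * \<phi> (Suc n) x j"
      have "d n ?g = (\<lambda>_. 0)"
        unfolding free_hom_simps(4)[OF d g y\<phi>] free_hom_simps(6)[OF d \<phi>x y(2)]
          \<phi>_comm[OF x] fx[symmetric] by (rule gf)
      moreover have "?g \<in> carrier (Fr (G (Suc n)))"
        using g y\<phi> by simp
      ultimately have "?g \<in> ?ZG (Suc n)"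
        by (simp add: cycles_simps)
      then obtain g' where g': "g' \<in> carrier (Fr (G (Suc (Suc n))))" and dg': "d (Suc n) g' = ?g"
        using free_resolutionD(4)[OF G, of "Suc n"] by (metis (no_types, lifting) imageE)
      have nx: "(\<lambda>j. - x j) \<in> carrier (Fr (F (Suc n)))"
        using x by simp
      have "\<delta> (Suc n) (interleave g' (\<lambda>j. - x j)) = u"
        unfolding \<delta>S u dg' free_hom_simps(7)[OF \<phi> x] free_hom_simps(7)[OF c x] fx by simp
      then show ?thesis
        using mem[OF g' nx] by blast
    qed
    ultimately show ?thesis
      unfolding Suc by blast
  qed
  have "finite (H i)" for i
    using free_resolutionD(1)[OF F] free_resolutionD(1)[OF G]
    by (auto simp: H_def interleave_sets_def split: nat.split)
  then have "free_resolution ?J' H \<delta>"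
    unfolding free_resolution_def using H0 \<delta>_hom exact by simp
  moreover have "minimal_diff H \<delta>"
    unfolding minimal_diff_def
  proof (intro allI ballI)
    fix i u j assume u: "u \<in> carrier (Fr (H (Suc i)))"
    note uG = even_hom[OF u] and uF = odd_hom[OF u]
    have "d i (\<lambda>j. u (2 * j)) k \<in> \<mm>" for k
      using Gmin uG unfolding minimal_diff_def by blast
    \<comment> \<open>The factor \<open>y\<close> alone brings the connecting block into
      \<open>\<mm>\<close>, whatever the entries of \<phi>.\<close>
    moreover have "y * \<phi> i (\<lambda>j. u (Suc (2 * j))) k \<in> \<mm>" for k
      using ideal_mult[OF free_hom_simps(2)[OF \<phi> uF] y(1)] by (simp add: mult.commute)
    moreover have "c n (\<lambda>j. u (Suc (2 * j))) k \<in> \<mm>" if "i = Suc n" for n k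
      using Fmin uF unfolding minimal_diff_def that by blast
    ultimately show "\<delta> i u j \<in> \<mm>"
      by (cases i) (auto simp: \<delta>_def interleave_def)
  qed
  \<comment> \<open>\<open>F b\<close> sits in degree \<open>Suc b\<close>, and \<open>ab\<close>
    keeps \<open>G\<close> from reaching beyond it.\<close>
  moreover have "H (Suc b) \<noteq> {}" and "\<forall>i>Suc b. H i = {}"
    using Ftop Gtop ab by (auto simp: H_def interleave_sets_def split: nat.split)
  ultimately show ?thesis
    unfolding has_min_res_def by blast
qed

end

section \<open>Projective dimension from a minimal free resolution\<close>

lemma quot_module_simps:
  "carrier (quot_module R I) = carrier (R Quot I)"
  "\<zero>\<^bsub>quot_module R I\<^esub> = \<zero>\<^bsub>R Quot I\<^esub>"
  "x \<oplus>\<^bsub>quot_module R I\<^esub> y = x \<oplus>\<^bsub>R Quot I\<^esub> y"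
  "r \<odot>\<^bsub>quot_module R I\<^esub> x = (I +>\<^bsub>R\<^esub> r) \<otimes>\<^bsub>R Quot I\<^esub> x"
  by (simp_all add: quot_module_def ring.extend_def module.fields_def)

lemma module_quot_module:
  assumes "ideal I R" and "cring R"
  shows "module R (quot_module R I)"
proof -
  interpret ideal I R by fact
  interpret R: cring R by fact
  interpret Q: cring "R Quot I"
    by (rule quotient_is_cring) fact
  note hom = rcos_ring_hom
  show ?thesis
  proof (rule moduleI)
    show "abelian_group (quot_module R I)"
    proof (rule abelian_groupI)
      fix x assume "x \<in> carrier (quot_module R I)"
      then show "\<exists>y\<in>carrier (quot_module R I). y \<oplus>\<^bsub>quot_module R I\<^esub> x = \<zero>\<^bsub>quot_module R I\<^esub>"
        by (intro bexI[of _ "\<ominus>\<^bsub>R Quot I\<^esub> x"]) (simp_all add: quot_module_simps Q.l_neg)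
    qed (simp_all add: quot_module_simps Q.a_ac)
  qed (use ring_hom_closed[OF hom] ring_hom_add[OF hom] ring_hom_mult[OF hom] ring_hom_one[OF hom]
      in \<open>simp_all add: quot_module_simps Q.l_distr Q.r_distr Q.m_assoc R.is_cring\<close>)
qed

lemma projective_resolutionD:
  assumes "projective_resolution R M P d e"
  shows "projective_module R (P i)" "module R (P i)"
    "e \<in> mod_hom R (P 0) M" "d i \<in> mod_hom R (P (Suc i)) (P i)" "e ` carrier (P 0) = carrier M"
    "cycles P d (a_kernel (P 0) M e) i = d i ` carrier (P (Suc i))"
  using assms
  by (auto simp: projective_resolution_def projective_module_def cycles_def a_kernel_def'
      split: nat.split)

context unital_subring
begin

text \<open>The augmentation from degree 0. \<open>B\<close> stays a variable so that the facts
  apply to the \<open>B 0\<close> of a resolution.\<close>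

lemma quot_proj:
  assumes J: "ideal J R" and "B = {0}"
  shows quot_proj_hom: "(\<lambda>v. J +>\<^bsub>R\<^esub> v 0) \<in> mod_hom R (Fr B) (quot_module R J)"
    and quot_proj_surj: "(\<lambda>v. J +>\<^bsub>R\<^esub> v 0) ` carrier (Fr B) = carrier (quot_module R J)"
    and quot_proj_eq_iff: "v \<in> carrier (Fr B) \<Longrightarrow> w \<in> carrier (Fr B) \<Longrightarrow>
      J +>\<^bsub>R\<^esub> v 0 = J +>\<^bsub>R\<^esub> w 0 \<longleftrightarrow> v 0 - w 0 \<in> J"
    and quot_proj_zero: "J +>\<^bsub>R\<^esub> 0 = \<zero>\<^bsub>quot_module R J\<^esub>"
proof -
  interpret ideal J R by fact
  interpret R: cring R by (rule cring_ring_of)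
  note hom = rcos_ring_hom
  show h: "(\<lambda>v. J +>\<^bsub>R\<^esub> v 0) \<in> mod_hom R (Fr B) (quot_module R J)"
    using ring_hom_closed[OF hom] ring_hom_add[OF hom] ring_hom_mult[OF hom]
    by (intro mod_homI) (auto simp: quot_module_simps)
  show "J +>\<^bsub>R\<^esub> 0 = \<zero>\<^bsub>quot_module R J\<^esub>"
    using mod_hom_zero[OF module_free module_quot_module[OF J cring_ring_of] h] by simp
  show "J +>\<^bsub>R\<^esub> v 0 = J +>\<^bsub>R\<^esub> w 0 \<longleftrightarrow> v 0 - w 0 \<in> J"
    if "v \<in> carrier (Fr B)" "w \<in> carrier (Fr B)"
  proof -
    have vw: "v 0 \<in> S" "w 0 \<in> S"
      using that by auto
    have "\<ominus>\<^bsub>R\<^esub> w 0 = - w 0"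
      using vw by (intro R.sum_zero_eq_neg[symmetric]) simp_all
    then have "v 0 \<ominus>\<^bsub>R\<^esub> w 0 = v 0 - w 0"
      by (simp add: a_minus_def)
    then show ?thesis
      using quotient_eq_iff_same_a_r_cos[OF J, of "v 0" "w 0"] vw by simp
  qed
  show "(\<lambda>v. J +>\<^bsub>R\<^esub> v 0) ` carrier (Fr B) = carrier (quot_module R J)"
  proof
    show "(\<lambda>v. J +>\<^bsub>R\<^esub> v 0) ` carrier (Fr B) \<subseteq> carrier (quot_module R J)"
      using mod_homD(1)[OF h] by blast
    show "carrier (quot_module R J) \<subseteq> (\<lambda>v. J +>\<^bsub>R\<^esub> v 0) ` carrier (Fr B)"
    proof
      fix A assume "A \<in> carrier (quot_module R J)"
      then obtain a where "a \<in> S" "A = J +>\<^bsub>R\<^esub> a"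
        by (auto simp: quot_module_simps FactRing_def A_RCOSETS_def')
      then show "A \<in> (\<lambda>v. J +>\<^bsub>R\<^esub> v 0) ` carrier (Fr B)"
        using assms(2) by (intro image_eqI[of _ _ "\<lambda>j. if j = 0 then a else 0"]) auto
    qed
  qed
qed

lemma pdim_le_free_resolution:
  assumes J: "ideal J R" and res: "free_resolution J B d" and len: "\<And>i. i > f \<Longrightarrow> B i = {}"
  shows "pdim R (quot_module R J) \<le> enat f"
proof -
  let ?M = "quot_module R J"
  \<comment> \<open>Functions constant in the second argument embed the vectors into the type that
    \<open>pdim\<close> prescribes for a module with elements of type \<open>'r set\<close>.\<close>
  define h :: "(nat \<Rightarrow> 'r) \<Rightarrow> nat \<Rightarrow> 'r set \<Rightarrow> 'r" where "h v = (\<lambda>j _. v j)" for v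
  have inj: "inj_on h A" for A
    by (rule inj_onI) (metis h_def ext)
  define P where "P i = transport h (Fr (B i))" for i
  define k where "k i = inv_into (carrier (Fr (B i))) h" for i
  have k_h: "k i (h v) = v" if "v \<in> carrier (Fr (B i))" for i v
    unfolding k_def using that by (rule inv_into_f_f[OF inj])
  have carr: "carrier (P i) = h ` carrier (Fr (B i))" for i
    unfolding P_def transport_simps ..
  have k_hom: "k i \<in> mod_hom R (P i) (Fr (B i))" for i
    unfolding k_def P_def by (rule transport_inv_hom[OF module_free inj])
  have h_hom: "h \<in> mod_hom R (Fr (B i)) (P i)" for i
    unfolding P_def by (rule transport_hom[OF inj])
  define D where "D i x = h (d i (k (Suc i) x))" for i x
  define e where "e x = J +>\<^bsub>R\<^esub> k 0 x 0" for x
  note B0 = free_resolutionD(2)[OF res] and d = free_resolutionD(3)[OF res]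
  note \<pi> = quot_proj_hom[OF J B0]
  have imD: "D i ` carrier (P (Suc i)) = h ` d i ` carrier (Fr (B (Suc i)))" for i
    unfolding D_def carr image_image using k_h by (auto simp: image_iff)
  have "projective_resolution R ?M P D e"
    unfolding projective_resolution_def
  proof (intro conjI allI)
    show "projective_module R (P i)" for i
      unfolding P_def by (rule projective_free[OF free_resolutionD(1)[OF res] inj])
    show "e \<in> mod_hom R (P 0) ?M"
      unfolding e_def by (rule mod_hom_comp[OF k_hom \<pi>])
    show "D i \<in> mod_hom R (P (Suc i)) (P i)" for i
      unfolding D_def by (rule mod_hom_comp[OF mod_hom_comp[OF k_hom d] h_hom])
    have "e ` carrier (P 0) = (\<lambda>v. J +>\<^bsub>R\<^esub> v 0) ` carrier (Fr (B 0))"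
      unfolding e_def carr image_image using k_h by (auto simp: image_iff)
    then show "e ` carrier (P 0) = carrier ?M"
      using quot_proj_surj[OF J B0] by simp
    have "a_kernel (P 0) ?M e = h ` {v \<in> carrier (Fr (B 0)). J +>\<^bsub>R\<^esub> v 0 = \<zero>\<^bsub>?M\<^esub>}"
      unfolding a_kernel_def' e_def carr using k_h by (auto simp: image_iff)
    also have "{v \<in> carrier (Fr (B 0)). J +>\<^bsub>R\<^esub> v 0 = \<zero>\<^bsub>?M\<^esub>} = {v \<in> carrier (Fr (B 0)). v 0 \<in> J}"
      using quot_proj_eq_iff[OF J B0, of _ "\<lambda>_. 0"] quot_proj_zero[OF J B0] by auto
    also have "\<dots> = d 0 ` carrier (Fr (B (Suc 0)))"
      using free_resolutionD(4)[OF res, of 0] by (simp only: cycles_simps)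
    finally show "a_kernel (P 0) ?M e = D 0 ` carrier (P (Suc 0))"
      unfolding imD .
    show "a_kernel (P (Suc i)) (P i) (D i) = D (Suc i) ` carrier (P (Suc (Suc i)))" for i
    proof -
      have "\<zero>\<^bsub>P i\<^esub> = h (\<lambda>_. 0)"
        by (simp add: P_def transport_simps)
      then have "a_kernel (P (Suc i)) (P i) (D i) = h ` {v \<in> carrier (Fr (B (Suc i))). d i v = (\<lambda>_. 0)}"
        unfolding a_kernel_def' D_def carr using k_h by (auto simp: image_iff inj_eq[OF inj])
      also have "{v \<in> carrier (Fr (B (Suc i))). d i v = (\<lambda>_. 0)} = d (Suc i) ` carrier (Fr (B (Suc (Suc i))))"
        using free_resolutionD(4)[OF res, of "Suc i"] by (simp add: cycles_simps)
      finally show ?thesis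
        unfolding imD .
    qed
  qed
  moreover have "carrier (P i) = {\<zero>\<^bsub>P i\<^esub>}" if "i > f" for i
    using len[OF that] by (auto simp: P_def transport_simps image_iff h_def intro!: exI[of _ "\<lambda>_. 0"])
  ultimately show ?thesis
    unfolding pdim_def by (intro Inf_lower) blast
qed

end

context unital_subring_ideal
begin

text \<open>
  Comparing the minimal free resolution with a shorter projective one makes the identity of the
  last free module factor, up to sign, through its differential, whose entries lie in \<open>\<mm>\<close>.
\<close>
lemma minimal_resolution_le:
  fixes P :: "nat \<Rightarrow> ('r, nat \<Rightarrow> 'r set \<Rightarrow> 'r) module"
  assumes J: "ideal J R" and res: "free_resolution J B d" and min: "minimal_diff B d"
    and top: "B f \<noteq> {}" and above: "B (Suc f) = {}"
    and P: "projective_resolution R (quot_module R J) P D e"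
    and len: "\<And>i. i > l \<Longrightarrow> carrier (P i) = {\<zero>\<^bsub>P i\<^esub>}"
  shows "f \<le> l"
proof (rule ccontr)
  assume "\<not> f \<le> l"
  then obtain k where k: "f = Suc k" and fl: "f > l"
    by (cases f) auto
  let ?M = "quot_module R J"
  have M: "module R ?M"
    by (rule module_quot_module[OF J cring_ring_of])
  note B0 = free_resolutionD(2)[OF res] and d = free_resolutionD(3)[OF res]
    and fin = free_resolutionD(1)[OF res]
  note \<pi> = quot_proj_hom[OF J B0] and \<pi>_surj = quot_proj_surj[OF J B0]
    and \<pi>_eq = quot_proj_eq_iff[OF J B0] and \<pi>_zero = quot_proj_zero[OF J B0]
  note PD = projective_resolutionD[OF P]
  let ?Z = "{v \<in> carrier (Fr (B 0)). v 0 \<in> J}" and ?W = "a_kernel (P 0) ?M e"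
  have Z_iff: "v \<in> ?Z \<longleftrightarrow> J +>\<^bsub>R\<^esub> v 0 = \<zero>\<^bsub>?M\<^esub>" if "v \<in> carrier (Fr (B 0))" for v
    using \<pi>_eq[OF that, of "\<lambda>_. 0"] \<pi>_zero that by auto
  \<comment> \<open>Comparison maps over the identity of the quotient: \<alpha> from the free
    resolution to \<open>P\<close>, then \<beta> back.\<close>
  obtain \<alpha>0 where \<alpha>0: "\<alpha>0 \<in> mod_hom R (Fr (B 0)) (P 0)"
    and e\<alpha>0: "\<forall>v\<in>carrier (Fr (B 0)). e (\<alpha>0 v) = J +>\<^bsub>R\<^esub> v 0"
    using free_lift[OF fin PD(2) M PD(3) \<pi>] PD(5) \<pi>_surj by blast
  have "\<exists>\<alpha>. \<alpha> 0 = \<alpha>0 \<and> (\<forall>i. \<alpha> i \<in> mod_hom R (Fr (B i)) (P i)) \<and>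
    (\<forall>i. \<forall>v\<in>carrier (Fr (B (Suc i))). D i (\<alpha> (Suc i) v) = \<alpha> i (d i v))"
  proof (rule chain_map_exists[where Z = ?Z and W = ?W])
    show "\<alpha>0 \<in> mod_hom R (Fr (B 0)) (P 0)" by (rule \<alpha>0)
    show "\<alpha>0 ` ?Z \<subseteq> ?W"
      using e\<alpha>0 Z_iff mod_homD(1)[OF \<alpha>0] by (auto simp: a_kernel_def' simp del: free_simps)
    show "\<exists>h\<in>mod_hom R (Fr (B (Suc i))) (P (Suc i)). \<forall>x\<in>carrier (Fr (B (Suc i))). D i (h x) = u x"
      if "u \<in> mod_hom R (Fr (B (Suc i))) (P i)"
        "u ` carrier (Fr (B (Suc i))) \<subseteq> D i ` carrier (P (Suc i))" for i u
      by (rule free_lift[OF fin PD(2) PD(2) PD(4) that])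
  qed (use module_free d PD free_resolutionD(4)[OF res] in simp_all)
  then obtain \<alpha> where \<alpha>_0: "\<alpha> 0 = \<alpha>0" and \<alpha>: "\<And>i. \<alpha> i \<in> mod_hom R (Fr (B i)) (P i)"
    and \<alpha>_comm: "\<And>i v. v \<in> carrier (Fr (B (Suc i))) \<Longrightarrow> D i (\<alpha> (Suc i) v) = \<alpha> i (d i v)"
    by blast
  \<comment> \<open>Test modules for \<open>P i\<close> have elements that are functions of some
    \<open>p\<close>. A vector is encoded by decoding an index from \<open>p\<close> and reading
    that entry; indicator functions \<open>p\<close> recover every entry.\<close>
  define ia :: "(nat \<Rightarrow> 'r) \<Rightarrow> (nat \<Rightarrow> 'r set \<Rightarrow> 'r) \<Rightarrow> 'r"
    where "ia v p = v (LEAST i. p i {} = 1)" for v p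
  have ia: "inj ia"
  proof (rule injI)
    fix v w assume eq: "ia v = ia w"
    show "v = w"
    proof
      fix i :: nat
      have "(LEAST j. (if j = i then 1 else 0 :: 'r) = 1) = i"
        by (rule Least_equality) (auto split: if_splits)
      then show "v i = w i"
        using fun_cong[OF eq, of "\<lambda>j _. if j = i then 1 else 0"] by (simp add: ia_def)
    qed
  qed
  \<comment> \<open>A set is encoded by the test whether \<open>p\<close> marks it; the indicator of
    \<open>A\<close> tells it from every other set.\<close>
  define ib :: "'r set \<Rightarrow> (nat \<Rightarrow> 'r set \<Rightarrow> 'r) \<Rightarrow> 'r"
    where "ib A p = (if p 0 A = 1 then 1 else 0)" for A p
  have ib: "inj ib"
  proof (rule injI)
    fix A C assume eq: "ib A = ib C"
    show "A = C"
      using fun_cong[OF eq, of "\<lambda>_ T. if T = A then 1 else 0"]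
      by (simp add: ib_def split: if_splits)
  qed
  have "e ` carrier (P 0) \<subseteq> (\<lambda>v. J +>\<^bsub>R\<^esub> v 0) ` carrier (Fr (B 0))"
    using PD(5) \<pi>_surj by simp
  then obtain \<beta>0 where \<beta>0: "\<beta>0 \<in> mod_hom R (P 0) (Fr (B 0))"
    and \<pi>\<beta>0: "\<forall>x\<in>carrier (P 0). J +>\<^bsub>R\<^esub> \<beta>0 x 0 = e x"
    using projective_lift[OF PD(1) module_free M ia ib \<pi> PD(3)] by blast
  have "\<exists>\<beta>. \<beta> 0 = \<beta>0 \<and> (\<forall>i. \<beta> i \<in> mod_hom R (P i) (Fr (B i))) \<and>
    (\<forall>i. \<forall>x\<in>carrier (P (Suc i)). d i (\<beta> (Suc i) x) = \<beta> i (D i x))"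
  proof (rule chain_map_exists[where Z = ?W and W = ?Z])
    show "\<beta>0 \<in> mod_hom R (P 0) (Fr (B 0))" by (rule \<beta>0)
    show "\<beta>0 ` ?W \<subseteq> ?Z"
      using \<pi>\<beta>0 Z_iff mod_homD(1)[OF \<beta>0] by (auto simp: a_kernel_def' simp del: free_simps)
    show "\<exists>h\<in>mod_hom R (P (Suc i)) (Fr (B (Suc i))). \<forall>x\<in>carrier (P (Suc i)). d i (h x) = u x"
      if "u \<in> mod_hom R (P (Suc i)) (Fr (B i))"
        "u ` carrier (P (Suc i)) \<subseteq> d i ` carrier (Fr (B (Suc i)))" for i u
      by (rule projective_lift[OF PD(1) module_free module_free ia ia d that])
  qed (use module_free d PD free_resolutionD(4)[OF res] in simp_all)
  then obtain \<beta> where \<beta>_0: "\<beta> 0 = \<beta>0" and \<beta>: "\<And>i. \<beta> i \<in> mod_hom R (P i) (Fr (B i))"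
    and \<beta>_comm: "\<And>i x. x \<in> carrier (P (Suc i)) \<Longrightarrow> d i (\<beta> (Suc i) x) = \<beta> i (D i x)"
    by blast
  \<comment> \<open>\<beta> \<alpha> and the identity cover the same map of the quotient, so their
    difference is null-homotopic.\<close>
  define \<gamma> where "\<gamma> i v = (\<lambda>j. \<beta> i (\<alpha> i v) j - v j)" for i v
  have \<beta>\<alpha>: "(\<lambda>v. \<beta> i (\<alpha> i v)) \<in> mod_hom R (Fr (B i)) (Fr (B i))" for i
    by (rule mod_hom_comp[OF \<alpha> \<beta>])
  have \<gamma>: "\<gamma> i \<in> mod_hom R (Fr (B i)) (Fr (B i))" for i
    unfolding \<gamma>_def[abs_def] by (rule free_hom_diff[OF \<beta>\<alpha>]) (rule mod_homI, auto)
  have "\<exists>h. (\<forall>i. h i \<in> mod_hom R (Fr (B i)) (Fr (B (Suc i)))) \<and>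
    (\<forall>i. \<forall>v\<in>carrier (Fr (B (Suc i))).
      d (Suc i) (h (Suc i) v) = (\<lambda>j. \<gamma> (Suc i) v j - h i (d i v) j))"
  proof (rule homotopy_exists[OF res \<gamma>])
    show "\<gamma> 0 v 0 \<in> J" if v: "v \<in> carrier (Fr (B 0))" for v
    proof -
      have "J +>\<^bsub>R\<^esub> \<beta> 0 (\<alpha> 0 v) 0 = J +>\<^bsub>R\<^esub> v 0"
        using \<pi>\<beta>0 e\<alpha>0 v mod_homD(1)[OF \<alpha>0 v] by (simp only: \<alpha>_0 \<beta>_0)
      then show ?thesis
        using \<pi>_eq[OF mod_homD(1)[OF \<beta>\<alpha> v] v] by (simp add: \<gamma>_def)
    qed
    show "d i (\<gamma> (Suc i) v) = \<gamma> i (d i v)" if v: "v \<in> carrier (Fr (B (Suc i)))" for i v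
    proof -
      have "d i (\<gamma> (Suc i) v) = (\<lambda>j. d i (\<beta> (Suc i) (\<alpha> (Suc i) v)) j - d i v j)"
        unfolding \<gamma>_def by (rule free_hom_simps(5)[OF d mod_homD(1)[OF \<beta>\<alpha> v] v])
      also have "d i (\<beta> (Suc i) (\<alpha> (Suc i) v)) = \<beta> i (\<alpha> i (d i v))"
        using \<beta>_comm[OF mod_homD(1)[OF \<alpha> v]] \<alpha>_comm[OF v] by simp
      finally show ?thesis
        by (simp only: \<gamma>_def)
    qed
  qed
  then obtain h where h: "\<And>i. h i \<in> mod_hom R (Fr (B i)) (Fr (B (Suc i)))"
    and dh: "\<And>i v. v \<in> carrier (Fr (B (Suc i))) \<Longrightarrow>
      d (Suc i) (h (Suc i) v) = (\<lambda>j. \<gamma> (Suc i) v j - h i (d i v) j)"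
    by blast
  \<comment> \<open>The homotopy identity is evaluated at a top basis vector. No basis lies above,
    so the \<open>d h\<close> term vanishes, and triviality of \<open>P f\<close> kills \<beta>
    \<alpha>; what remains is \<open>- 1 = h (d v) b\<close>.\<close>
  obtain b where b: "b \<in> B f"
    using top by blast
  define v :: "nat \<Rightarrow> 'r" where "v = (\<lambda>j. if j = b then 1 else 0)"
  have v: "v \<in> carrier (Fr (B (Suc k)))"
    using b k by (auto simp: v_def)
  have "h (Suc k) v \<in> carrier (Fr {})"
    using mod_homD(1)[OF h v] above k by simp
  then have "h (Suc k) v = (\<lambda>_. 0)"
    by auto
  then have "\<gamma> (Suc k) v b = h k (d k v) b"
    using fun_cong[OF dh[OF v], of b] free_hom_zero[OF d] by simp
  moreover have "\<beta> (Suc k) (\<alpha> (Suc k) v) = (\<lambda>_. 0)"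
  proof -
    have "\<alpha> (Suc k) v = \<zero>\<^bsub>P (Suc k)\<^esub>"
      using mod_homD(1)[OF \<alpha> v] len fl k by auto
    then show ?thesis
      using mod_hom_zero[OF PD(2) module_free \<beta>] by simp
  qed
  ultimately have "- 1 = h k (d k v) b"
    by (simp add: \<gamma>_def v_def)
  moreover have "h k (d k v) b \<in> \<mm>"
    using min v unfolding minimal_diff_def
    by (intro free_hom_ideal[OF fin h mod_homD(1)[OF d v]]) blast
  ultimately show False
    using one_notin_ideal ideal_uminus[of "- 1"] by (metis minus_minus)
qed

theorem pdim_quot_module:
  assumes J: "ideal J R" and "has_min_res J f"
  shows "pdim R (quot_module R J) = enat f"
proof -
  obtain B d where res: "free_resolution J B d" and min: "minimal_diff B d"
    and top: "B f \<noteq> {}" and above: "\<forall>i>f. B i = {}"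
    using assms(2) unfolding has_min_res_def by blast
  have "enat f \<le> pdim R (quot_module R J)"
    unfolding pdim_def
  proof (rule Inf_greatest)
    fix x assume "x \<in> {enat l |l. \<exists>(P :: nat \<Rightarrow> ('r, nat \<Rightarrow> 'r set \<Rightarrow> 'r) module) d e.
      projective_resolution R (quot_module R J) P d e \<and> (\<forall>i>l. carrier (P i) = {\<zero>\<^bsub>P i\<^esub>})}"
    then obtain l P D e where x: "x = enat l"
      and P: "projective_resolution R (quot_module R J) (P :: nat \<Rightarrow> ('r, nat \<Rightarrow> 'r set \<Rightarrow> 'r) module) D e"
      and len: "\<forall>i>l. carrier (P i) = {\<zero>\<^bsub>P i\<^esub>}"
      by blast
    have "f \<le> l"
      by (rule minimal_resolution_le[OF J res min top _ P]) (use above len in auto)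
    then show "enat f \<le> x" by (simp add: x)
  qed
  moreover have "pdim R (quot_module R J) \<le> enat f"
    by (rule pdim_le_free_resolution[OF J res]) (use above in blast)
  ultimately show ?thesis by simp
qed

end

section \<open>Square-free monomial ideals\<close>

type_synonym 'k mpoly = "(nat \<Rightarrow>\<^sub>0 nat) \<Rightarrow>\<^sub>0 'k"

lemma keys_nat_add: "Poly_Mapping.keys (s + t) = Poly_Mapping.keys s \<union> Poly_Mapping.keys t"
  for s t :: "nat \<Rightarrow>\<^sub>0 nat"
  by (auto simp: in_keys_iff lookup_add)

lemma keys_multE:
  assumes "t \<in> Poly_Mapping.keys (f * g)"
  obtains a b where "t = a + b" "a \<in> Poly_Mapping.keys f" "b \<in> Poly_Mapping.keys g"
  using keys_mult[of f g] assms by blast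

lemma keys_uminus: "Poly_Mapping.keys (- f) = Poly_Mapping.keys f"
  for f :: "'a \<Rightarrow>\<^sub>0 'b::ab_group_add"
  by (auto simp: in_keys_iff)

text \<open>The carrier of \<open>mpoly_ring N\<close> as a set, to be treated as a unital subring
  of the polynomials in all variables.\<close>

definition mpolys :: "nat \<Rightarrow> 'k::field mpoly set" where
  "mpolys N = {f. \<forall>t\<in>Poly_Mapping.keys f. Poly_Mapping.keys t \<subseteq> {1..N}}"

text \<open>The exponent vector 0 belongs to the constant term.\<close>

definition irrelevant_ideal :: "nat \<Rightarrow> 'k::field mpoly set" where
  "irrelevant_ideal N = {f \<in> mpolys N. 0 \<notin> Poly_Mapping.keys f}"

lemma mpoly_ring_eq: "mpoly_ring N = ring_of (mpolys N)"
  by (simp add: mpoly_ring_def ring_of_def mpolys_def)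

interpretation mpoly: unital_subring_ideal "mpolys N :: 'k::field mpoly set" "irrelevant_ideal N" for N
proof
  fix a b :: "'k mpoly"
  show add: "a + b \<in> mpolys N" if "a \<in> mpolys N" "b \<in> mpolys N"
    using that keys_add[of a b] by (auto simp: mpolys_def)
  show mult: "a * b \<in> mpolys N" if "a \<in> mpolys N" "b \<in> mpolys N"
    using that by (fastforce simp: mpolys_def keys_nat_add elim!: keys_multE simp del: atLeastAtMost_iff)
  show "- a \<in> mpolys N" if "a \<in> mpolys N"
    using that by (simp add: mpolys_def keys_uminus)
  show "a + b \<in> irrelevant_ideal N" if "a \<in> irrelevant_ideal N" "b \<in> irrelevant_ideal N"
    using that add keys_add[of a b] by (auto simp: irrelevant_ideal_def)
  show "a * b \<in> irrelevant_ideal N" if "a \<in> mpolys N" "b \<in> irrelevant_ideal N"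
  proof -
    \<comment> \<open>Exponents add up to 0 only if both are 0, and \<open>b\<close> has no constant
      term.\<close>
    have "0 \<notin> Poly_Mapping.keys (a * b)"
    proof
      assume "0 \<in> Poly_Mapping.keys (a * b)"
      then obtain s t where "0 = s + t" "t \<in> Poly_Mapping.keys b"
        by (rule keys_multE)
      moreover have "Poly_Mapping.keys (s + t) = {}"
        by (simp flip: \<open>0 = s + t\<close>)
      then have "t = 0"
        by (simp add: keys_nat_add poly_mapping_eqI in_keys_iff)
      ultimately show False
        using that by (simp add: irrelevant_ideal_def)
    qed
    then show ?thesis
      using that mult by (simp add: irrelevant_ideal_def)
  qed
qed (auto simp: mpolys_def irrelevant_ideal_def)

section \<open>Square-free monomials and their supports\<close>

definition sqfree :: "nat set \<Rightarrow> nat \<Rightarrow>\<^sub>0 nat" where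
  "sqfree U = (\<Sum>i\<in>U. Poly_Mapping.single i 1)"

lemma lookup_sqfree: "finite U \<Longrightarrow> Poly_Mapping.lookup (sqfree U) i = (if i \<in> U then 1 else 0)"
  by (simp add: sqfree_def lookup_sum lookup_single when_def)

lemma keys_sqfree: "finite U \<Longrightarrow> Poly_Mapping.keys (sqfree U) = U"
  by (simp add: set_eq_iff in_keys_iff lookup_sqfree)

lemma prod_mvar: "finite U \<Longrightarrow> (\<Prod>i\<in>U. mvar i) = Poly_Mapping.single (sqfree U) 1"
  by (induction U rule: finite_induct) (simp_all add: sqfree_def mvar_def mult_single)

lemma lookup_mult_single:
  fixes f :: "'k::field mpoly"
  shows "Poly_Mapping.lookup (f * Poly_Mapping.single u 1) (t + u) = Poly_Mapping.lookup f t"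
proof -
  \<comment> \<open>For a fixed exponent \<open>l\<close> of \<open>f\<close> only
    \<open>q = u\<close> contributes, and cancelling \<open>u\<close> leaves
    \<open>l = t\<close>.\<close>
  have "(\<Sum>q. Poly_Mapping.lookup (Poly_Mapping.single u (1::'k)) q when t + u = l + q) = (1 when l = t)" for l
  proof -
    have "(\<lambda>q. Poly_Mapping.lookup (Poly_Mapping.single u (1::'k)) q when t + u = l + q)
        = (\<lambda>q. (1 when l = t) when q = u)"
      by (auto simp: lookup_single when_def)
    then show ?thesis
      by (simp only: Sum_any_when_equal)
  qed
  then show ?thesis
    by (simp add: lookup_mult mult_when)
qed

text \<open>Multiplication by a monomial shifts exponents injectively, so no terms merge or
  cancel.\<close>

lemma keys_mult_prod_mvar:
  fixes f :: "'k::field mpoly"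
  assumes "finite U"
  shows "Poly_Mapping.keys (f * (\<Prod>i\<in>U. mvar i)) = (\<lambda>t. t + sqfree U) ` Poly_Mapping.keys f"
proof
  show "Poly_Mapping.keys (f * (\<Prod>i\<in>U. mvar i)) \<subseteq> (\<lambda>t. t + sqfree U) ` Poly_Mapping.keys f"
    by (auto simp: prod_mvar assms elim!: keys_multE)
  show "(\<lambda>t. t + sqfree U) ` Poly_Mapping.keys f \<subseteq> Poly_Mapping.keys (f * (\<Prod>i\<in>U. mvar i))"
    by (auto simp: prod_mvar assms in_keys_iff lookup_mult_single)
qed

text \<open>Reduces membership in an additively closed set to the single terms of
  \<open>f\<close>.\<close>

lemma additive_span:
  fixes f :: "'a \<Rightarrow>\<^sub>0 'b::comm_monoid_add"
  assumes "0 \<in> A" and "\<And>a b. a \<in> A \<Longrightarrow> b \<in> A \<Longrightarrow> a + b \<in> A"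
    and "\<And>t. t \<in> Poly_Mapping.keys f \<Longrightarrow> Poly_Mapping.single t (Poly_Mapping.lookup f t) \<in> A"
  shows "f \<in> A"
proof -
  have "f = (\<Sum>t\<in>Poly_Mapping.keys f. Poly_Mapping.single t (Poly_Mapping.lookup f t))"
    by (rule poly_mapping_eqI)
      (simp add: lookup_sum lookup_single when_def sum.delta not_in_keys_iff_lookup_eq_zero)
  moreover have "(\<Sum>t\<in>T. Poly_Mapping.single t (Poly_Mapping.lookup f t)) \<in> A"
    if "finite T" "T \<subseteq> Poly_Mapping.keys f" for T
    using that by (induction T rule: finite_induct) (use assms in auto)
  ultimately show ?thesis
    using finite_keys by (metis order_refl)
qed

text \<open>
  A square-free monomial is given by its set of variables, so that a square-free monomial ideal
  becomes a family of sets and divisibility becomes inclusion in the support.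
\<close>
definition sqfree_ideal :: "nat \<Rightarrow> nat set set \<Rightarrow> 'k::field mpoly set" where
  "sqfree_ideal N \<G> = {f \<in> mpolys N. \<forall>t\<in>Poly_Mapping.keys f. \<exists>A\<in>\<G>. A \<subseteq> Poly_Mapping.keys t}"

lemma sqfree_ideal_empty: "(sqfree_ideal N {} :: 'k::field mpoly set) = {0}"
proof -
  have "f = 0" if "Poly_Mapping.keys f = {}" for f :: "'k mpoly"
    using that by (intro poly_mapping_eqI) (auto simp: in_keys_iff)
  then show ?thesis
    by (auto simp: sqfree_ideal_def)
qed

lemma sqfree_ideal_subset: "sqfree_ideal N \<G> \<subseteq> mpolys N"
  by (auto simp: sqfree_ideal_def)

lemma sqfree_ideal_add: "f \<in> sqfree_ideal N \<G> \<Longrightarrow> g \<in> sqfree_ideal N \<G> \<Longrightarrow> f + g \<in> sqfree_ideal N \<G>"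
  using keys_add[of f g] by (auto simp: sqfree_ideal_def)

lemma sqfree_ideal_mult: "f \<in> mpolys N \<Longrightarrow> g \<in> sqfree_ideal N \<G> \<Longrightarrow> f * g \<in> sqfree_ideal N \<G>"
  by (auto simp: sqfree_ideal_def keys_nat_add elim!: keys_multE) blast

lemma sqfree_ideal_mono: "\<G> \<subseteq> \<H> \<Longrightarrow> sqfree_ideal N \<G> \<subseteq> sqfree_ideal N \<H>"
  unfolding sqfree_ideal_def by blast

text \<open>Multiplying by the monomial adds \<open>U\<close> to the support of every exponent. This
  turns colon ideals into conditions on sets of variables.\<close>

lemma mult_prod_mvar_mem_iff:
  assumes "finite U" and "U \<subseteq> {1..N}" and "f \<in> mpolys N"
  shows "f * (\<Prod>i\<in>U. mvar i) \<in> sqfree_ideal N \<G> \<longleftrightarrow>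
    (\<forall>t\<in>Poly_Mapping.keys f. \<exists>A\<in>\<G>. A \<subseteq> Poly_Mapping.keys t \<union> U)"
  using assms by (auto simp: sqfree_ideal_def mpolys_def keys_mult_prod_mvar keys_nat_add keys_sqfree)

lemma prod_mvar_mem: "finite U \<Longrightarrow> U \<subseteq> {1..N} \<Longrightarrow> (\<Prod>i\<in>U. mvar i) \<in> mpolys N"
  by (simp add: mpolys_def prod_mvar keys_sqfree)

lemma single_eq_mult_prod_mvar:
  fixes c :: "'k::field"
  assumes "finite U" and "U \<subseteq> Poly_Mapping.keys t"
  obtains s where "Poly_Mapping.single t c = Poly_Mapping.single s c * (\<Prod>i\<in>U. mvar i)"
    "Poly_Mapping.keys s \<subseteq> Poly_Mapping.keys t"
proof
  \<comment> \<open>Inclusion in the support gives a pointwise inequality, so the subtraction of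
    exponents is not truncated.\<close>
  have "Poly_Mapping.lookup (sqfree U) i \<le> Poly_Mapping.lookup t i" for i
    using assms by (auto simp: lookup_sqfree in_keys_iff Suc_le_eq)
  then have "t - sqfree U + sqfree U = t"
    by (intro poly_mapping_eqI) (simp add: lookup_add lookup_minus)
  then show "Poly_Mapping.single t c = Poly_Mapping.single (t - sqfree U) c * (\<Prod>i\<in>U. mvar i)"
    by (simp add: prod_mvar assms(1) mult_single)
  show "Poly_Mapping.keys (t - sqfree U) \<subseteq> Poly_Mapping.keys t"
    by (auto simp: in_keys_iff lookup_minus)
qed

lemma ideal_sqfree_ideal: "ideal (sqfree_ideal N \<G> :: 'k::field mpoly set) (ring_of (mpolys N))"
proof (rule idealI)
  let ?R = "ring_of (mpolys N) :: 'k mpoly ring"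
  interpret R: cring ?R
    by (rule mpoly.cring_ring_of)
  show "ring ?R" ..
  show "subgroup (sqfree_ideal N \<G>) (add_monoid ?R)"
  proof
    show "sqfree_ideal N \<G> \<subseteq> carrier (add_monoid ?R)"
      by (auto simp: sqfree_ideal_def)
    show "\<one>\<^bsub>add_monoid ?R\<^esub> \<in> sqfree_ideal N \<G>"
      by (simp add: sqfree_ideal_def)
    show "f \<otimes>\<^bsub>add_monoid ?R\<^esub> g \<in> sqfree_ideal N \<G>"
      if "f \<in> sqfree_ideal N \<G>" "g \<in> sqfree_ideal N \<G>" for f g :: "'k mpoly"
      using that by (simp add: sqfree_ideal_add)
    show "inv\<^bsub>add_monoid ?R\<^esub> f \<in> sqfree_ideal N \<G>"
      if f: "f \<in> sqfree_ideal N \<G>" for f :: "'k mpoly"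
    proof -
      have "f \<in> mpolys N"
        using f by (simp add: sqfree_ideal_def)
      then have minus: "\<ominus>\<^bsub>?R\<^esub> f = - f"
        by (intro R.minus_equality) simp_all
      show ?thesis
        unfolding a_inv_def[symmetric] minus
        using f \<open>f \<in> mpolys N\<close> by (simp add: sqfree_ideal_def keys_uminus)
    qed
  qed
qed (simp_all add: sqfree_ideal_mult, metis mult.commute sqfree_ideal_mult)

text \<open>Each term of a member of \<open>sqfree_ideal\<close> is a multiple of a generator, so
  the termwise condition already describes the generated ideal.\<close>

lemma genideal_prod_mvar:
  assumes fin: "\<And>A. A \<in> \<G> \<Longrightarrow> A \<subseteq> {1..N}"
  shows "genideal (mpoly_ring N) ((\<lambda>A. \<Prod>i\<in>A. mvar i) ` \<G>) = (sqfree_ideal N \<G> :: 'k::field mpoly set)"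
proof -
  let ?R = "ring_of (mpolys N) :: 'k mpoly ring" and ?G = "(\<lambda>A. \<Prod>i\<in>A. mvar i) ` \<G> :: 'k mpoly set"
  interpret R: cring ?R
    by (rule mpoly.cring_ring_of)
  have finA: "finite A" if "A \<in> \<G>" for A
    using fin[OF that] finite_subset by blast
  have G: "?G \<subseteq> carrier ?R"
    using prod_mvar_mem[OF finA fin] by auto
  interpret I: ideal "genideal ?R ?G" ?R
    by (rule R.genideal_ideal[OF G])
  have "genideal ?R ?G \<subseteq> sqfree_ideal N \<G>"
  proof (rule R.genideal_minimal[OF ideal_sqfree_ideal])
    have "1 * (\<Prod>i\<in>A. mvar i) \<in> (sqfree_ideal N \<G> :: 'k mpoly set)" if "A \<in> \<G>" for A
      using that by (subst mult_prod_mvar_mem_iff[OF finA fin]) auto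
    then show "?G \<subseteq> sqfree_ideal N \<G>"
      by auto
  qed
  moreover have "f \<in> genideal ?R ?G" if f: "f \<in> sqfree_ideal N \<G>" for f
  proof (rule additive_span)
    show "0 \<in> genideal ?R ?G"
      using I.zero_closed by simp
    show "a + b \<in> genideal ?R ?G" if "a \<in> genideal ?R ?G" "b \<in> genideal ?R ?G" for a b
      using I.a_closed[OF that] by simp
    fix t assume t: "t \<in> Poly_Mapping.keys f"
    then obtain A where A: "A \<in> \<G>" "A \<subseteq> Poly_Mapping.keys t" and tN: "Poly_Mapping.keys t \<subseteq> {1..N}"
      using f by (auto simp: sqfree_ideal_def mpolys_def)
    obtain s where s: "Poly_Mapping.single t (Poly_Mapping.lookup f t) =
        Poly_Mapping.single s (Poly_Mapping.lookup f t) * (\<Prod>i\<in>A. mvar i)"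
      "Poly_Mapping.keys s \<subseteq> Poly_Mapping.keys t"
      using single_eq_mult_prod_mvar[OF finA[OF A(1)] A(2)] by blast
    have "Poly_Mapping.single s (Poly_Mapping.lookup f t) \<in> mpolys N"
      using subset_trans[OF s(2) tN] by (simp add: mpolys_def)
    moreover have "(\<Prod>i\<in>A. mvar i) \<in> genideal ?R ?G"
      using R.genideal_self[OF G] A(1) by blast
    ultimately show "Poly_Mapping.single t (Poly_Mapping.lookup f t) \<in> genideal ?R ?G"
      unfolding s(1) using I.I_l_closed by simp
  qed
  ultimately show ?thesis
    unfolding mpoly_ring_eq by blast
qed

text \<open>Terms divisible by the new monomial go into \<open>r\<close>; the others satisfy the old
  condition. The right-hand side is the form in which the cone delivers its ideal.\<close>

lemma sqfree_ideal_insert: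
  assumes U: "finite U" "U \<subseteq> {1..N}"
  shows "sqfree_ideal N (insert U \<G>) =
    {f + r * (\<Prod>i\<in>U. mvar i) | f r. f \<in> sqfree_ideal N \<G> \<and> r \<in> (mpolys N :: 'k::field mpoly set)}"
    (is "_ = ?J")
proof
  show "?J \<subseteq> sqfree_ideal N (insert U \<G>)"
  proof clarify
    fix f r :: "'k mpoly" assume "f \<in> sqfree_ideal N \<G>" "r \<in> mpolys N"
    then show "f + r * (\<Prod>i\<in>U. mvar i) \<in> sqfree_ideal N (insert U \<G>)"
      using sqfree_ideal_mono[of \<G> "insert U \<G>" N]
      by (intro sqfree_ideal_add) (auto simp: mult_prod_mvar_mem_iff[OF U])
  qed
  have memI: "f + r * (\<Prod>i\<in>U. mvar i) \<in> ?J" if "f \<in> sqfree_ideal N \<G>" "r \<in> mpolys N" for f r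
    using that by blast
  have zero: "0 \<in> sqfree_ideal N \<G>"
    by (simp add: sqfree_ideal_def)
  show "sqfree_ideal N (insert U \<G>) \<subseteq> ?J"
  proof
    fix f :: "'k mpoly" assume f: "f \<in> sqfree_ideal N (insert U \<G>)"
    show "f \<in> ?J"
    proof (rule additive_span)
      show "0 \<in> ?J"
        using memI[OF zero, of 0] by simp
      show "a + b \<in> ?J" if ab: "a \<in> ?J" "b \<in> ?J" for a b
      proof -
        obtain f r f' r' where "a = f + r * (\<Prod>i\<in>U. mvar i)" "b = f' + r' * (\<Prod>i\<in>U. mvar i)"
          and mem: "f \<in> sqfree_ideal N \<G>" "f' \<in> sqfree_ideal N \<G>" "r \<in> mpolys N" "r' \<in> mpolys N"
          using ab by blast
        then have eq: "a + b = (f + f') + (r + r') * (\<Prod>i\<in>U. mvar i)"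
          by (simp add: algebra_simps)
        show ?thesis
          unfolding eq using mem by (intro memI sqfree_ideal_add mpoly.add_mem)
      qed
      fix t assume t: "t \<in> Poly_Mapping.keys f"
      let ?m = "Poly_Mapping.single t (Poly_Mapping.lookup f t)"
      have tN: "Poly_Mapping.keys t \<subseteq> {1..N}"
        using f t by (auto simp: sqfree_ideal_def mpolys_def)
      show "?m \<in> ?J"
      proof (cases "U \<subseteq> Poly_Mapping.keys t")
        case True
        obtain s where s: "?m = Poly_Mapping.single s (Poly_Mapping.lookup f t) * (\<Prod>i\<in>U. mvar i)"
          "Poly_Mapping.keys s \<subseteq> Poly_Mapping.keys t"
          using single_eq_mult_prod_mvar[OF U(1) True] by blast
        have "Poly_Mapping.single s (Poly_Mapping.lookup f t) \<in> mpolys N"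
          using subset_trans[OF s(2) tN] by (simp add: mpolys_def)
        then show ?thesis
          using memI[OF zero] s(1) by simp
      next
        case False
        then have "?m \<in> sqfree_ideal N \<G>"
          using f t tN by (auto simp: sqfree_ideal_def mpolys_def)
        then show ?thesis
          using memI[of ?m 0] by simp
      qed
    qed
  qed
qed

text \<open>The cone in terms of sets of variables, with \<open>y\<close> the variable
  \<open>u\<close> and \<open>m'\<close> the product over \<open>U - {u}\<close>. The sets
  \<open>T\<close> stand for supports of exponents.\<close>

lemma has_min_res_insert:
  fixes N :: nat
  defines "min_res \<equiv> unital_subring_ideal.has_min_res (mpolys N :: 'k::field mpoly set) (irrelevant_ideal N)"
  assumes \<G>: "min_res (sqfree_ideal N \<G>) a" and \<K>: "min_res (sqfree_ideal N \<K>) b"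
    and ab: "a \<le> Suc b" and U: "U \<subseteq> {1..N}" and u: "u \<in> U"
    and colon: "\<And>T. (\<exists>A\<in>\<G>. A \<subseteq> T \<union> U) \<longleftrightarrow> (\<exists>A\<in>\<K>. A \<subseteq> T)"
    and factor: "\<And>T A. A \<in> \<K> \<Longrightarrow> A \<subseteq> T \<Longrightarrow> \<exists>A\<in>\<G>. A \<subseteq> T \<union> (U - {u})"
  shows "min_res (sqfree_ideal N (insert U \<G>)) (Suc b)"
proof -
  have fin: "finite U"
    using U finite_subset by blast
  let ?y = "\<Prod>i\<in>{u}. mvar i :: 'k mpoly" and ?m = "\<Prod>i\<in>U - {u}. mvar i :: 'k mpoly"
  have U_eq: "(\<Prod>i\<in>U. mvar i) = ?y * ?m"
    using prod.remove[OF fin u, of mvar] by simp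
  have y: "?y \<in> mpolys N"
    using U u by (intro prod_mvar_mem) auto
  have "sqfree {u} \<noteq> 0"
    using keys_sqfree[of "{u}"] by auto
  then have y': "?y \<in> irrelevant_ideal N"
    using y unfolding irrelevant_ideal_def prod_mvar[OF finite.insertI[OF finite.emptyI]] by simp
  have m: "?m \<in> mpolys N"
    using U fin by (intro prod_mvar_mem) auto
  show ?thesis
    unfolding sqfree_ideal_insert[OF fin U] U_eq min_res_def
  proof (rule mpoly.has_min_res_cone)
    show "r * (?y * ?m) \<in> sqfree_ideal N \<G> \<longleftrightarrow> r \<in> sqfree_ideal N \<K>" if "r \<in> mpolys N" for r
      unfolding U_eq[symmetric] mult_prod_mvar_mem_iff[OF fin U that] colon
      using that by (simp add: sqfree_ideal_def)
    show "r * ?m \<in> sqfree_ideal N \<G>" if "r \<in> sqfree_ideal N \<K>" for r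
    proof (subst mult_prod_mvar_mem_iff)
      show "\<forall>t\<in>Poly_Mapping.keys r. \<exists>A\<in>\<G>. A \<subseteq> Poly_Mapping.keys t \<union> (U - {u})"
        using that factor by (simp add: sqfree_ideal_def) blast
    qed (use fin U that in \<open>auto simp: sqfree_ideal_def\<close>)
  qed (use \<G> \<K> ab y y' m sqfree_ideal_mult sqfree_ideal_subset in \<open>simp_all add: min_res_def\<close>)
qed

section \<open>Path ideals\<close>

definition path_gens :: "nat \<Rightarrow> nat \<Rightarrow> nat set set" where
  "path_gens p k = (\<lambda>i. {i..<i + p}) ` {1..k}"

text \<open>The minimum with 2 folds the three cases for the remainder into one formula.\<close>

definition path_pdim :: "nat \<Rightarrow> nat \<Rightarrow> nat" where
  "path_pdim p n = 2 * (n div (p + 1)) + min 2 (n mod (p + 1))"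

text \<open>Yields the bound \<open>a \<le> Suc b\<close> on the lengths when the next generator is
  adjoined.\<close>

lemma path_pdim_Suc: "path_pdim p n \<le> path_pdim p (Suc n)"
  by (auto simp: path_pdim_def div_Suc mod_Suc)

lemma path_pdim_rec:
  assumes "2 \<le> n"
  shows "path_pdim p n = path_pdim p (n - 1 - p) + 2"
proof (cases "p + 1 \<le> n")
  case True
  then have "n div (p + 1) = Suc ((n - 1 - p) div (p + 1))" "n mod (p + 1) = (n - 1 - p) mod (p + 1)"
    using le_div_geq[of "p + 1" n] le_mod_geq[of "p + 1" n] by simp_all
  then show ?thesis
    by (simp add: path_pdim_def)
next
  \<comment> \<open>Here \<open>n \<le> p\<close>: the truncated \<open>n - 1 - p\<close> is 0, and
    the remainder \<open>n\<close> is at least 2.\<close>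
  case False
  then show ?thesis
    using assms by (simp add: path_pdim_def)
qed

lemma path_gens_Suc: "path_gens p (Suc k) = insert {Suc k..<Suc k + p} (path_gens p k)"
  by (simp add: path_gens_def atLeastAtMostSuc_conv)

text \<open>Strong induction, because the colon ideal goes back \<open>p + 1\<close>
  generators.\<close>

lemma has_min_res_path:
  assumes p: "p \<ge> 1" and "k + p \<le> N + 1"
  shows "unital_subring_ideal.has_min_res (mpolys N :: 'k::field mpoly set) (irrelevant_ideal N)
    (sqfree_ideal N (path_gens p k)) (path_pdim p k)"
  using assms(2)
proof (induction k rule: less_induct)
  case (less k)
  let ?min_res = "unital_subring_ideal.has_min_res (mpolys N :: 'k mpoly set) (irrelevant_ideal N)"
  have zero: "?min_res (sqfree_ideal N {}) 0"
    unfolding sqfree_ideal_empty by (rule mpoly.has_min_res_zero)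
  consider "k = 0" | "k = 1" | "k \<ge> 2" by linarith
  then show ?case
  proof cases
    case 1
    then show ?thesis
      using zero by (simp add: path_gens_def path_pdim_def)
  next
    case 2
    \<comment> \<open>The first generator is adjoined to the zero ideal, whose colon is again
      zero.\<close>
    have "?min_res (sqfree_ideal N (insert {1..<1 + p} {})) (Suc 0)"
      by (rule has_min_res_insert[OF zero zero, where u = p]) (use p less.prems 2 in auto)
    moreover have "path_gens p k = {{1..<1 + p}}" and "path_pdim p k = 1"
      using p 2 by (auto simp: path_gens_def path_pdim_def)
    ultimately show ?thesis by simp
  next
    case 3
    \<comment> \<open>Among the first \<open>k - 1\<close> generators, those up to \<open>l\<close>
      are exactly the ones without the variable \<open>k - 1\<close>; for
      \<open>k \<le> p + 1\<close> truncation gives 0 and none is left.\<close>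
    define l where "l = k - 1 - p"
    have IHl: "?min_res (sqfree_ideal N (path_gens p l)) (path_pdim p l)"
      using less.prems 3 by (intro less.IH) (auto simp: l_def)
    have IHk: "?min_res (sqfree_ideal N (path_gens p (k - 1))) (path_pdim p (k - 1))"
      using less.prems 3 by (intro less.IH) auto
    have notin: "k - 1 \<notin> A" if "A \<in> path_gens p l" for A
      using that by (auto simp: path_gens_def l_def)
    \<comment> \<open>The variable \<open>k - 1\<close> occurs in none of these generators, so the
      colon by it is the ideal itself and the length grows by one.\<close>
    have K: "?min_res (sqfree_ideal N (insert {k - 1} (path_gens p l))) (Suc (path_pdim p l))"
    proof (rule has_min_res_insert[OF IHl IHl])
      show "(\<exists>A\<in>path_gens p l. A \<subseteq> T \<union> {k - 1}) \<longleftrightarrow> (\<exists>A\<in>path_gens p l. A \<subseteq> T)" for T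
        using notin by blast
    qed (use 3 less.prems p in auto)
    have prev: "{k - 1..<k - 1 + p} \<in> path_gens p (k - 1)"
      unfolding path_gens_def by (rule imageI) (use 3 in simp)
    \<comment> \<open>Generator \<open>k - 1\<close> divides the variable \<open>k - 1\<close> times
      generator \<open>k\<close> without its last variable; this allows \<open>u = k + p - 1\<close>
      in \<open>factor\<close>.\<close>
    have prev_sub: "{k - 1..<k - 1 + p} \<subseteq> insert (k - 1) ({k..<k + p} - {k + p - 1})"
      using 3 by auto
    have gens_sub: "path_gens p l \<subseteq> path_gens p (k - 1)"
      by (auto simp: path_gens_def l_def)
    have "?min_res (sqfree_ideal N (insert {k..<k + p} (path_gens p (k - 1)))) (Suc (Suc (path_pdim p l)))"
    proof (rule has_min_res_insert[OF IHk K, where u = "k + p - 1"])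
      show "path_pdim p (k - 1) \<le> Suc (Suc (path_pdim p l))"
        using path_pdim_Suc[of p "k - 1"] path_pdim_rec[OF 3, of p] 3 by (simp add: l_def)
      show "\<exists>A\<in>path_gens p (k - 1). A \<subseteq> T \<union> ({k..<k + p} - {k + p - 1})"
        if "A \<in> insert {k - 1} (path_gens p l)" "A \<subseteq> T" for A T
        using that prev prev_sub gens_sub by blast
      show "(\<exists>A\<in>path_gens p (k - 1). A \<subseteq> T \<union> {k..<k + p}) \<longleftrightarrow>
          (\<exists>A\<in>insert {k - 1} (path_gens p l). A \<subseteq> T)" for T
      proof
        assume "\<exists>A\<in>path_gens p (k - 1). A \<subseteq> T \<union> {k..<k + p}"
        then obtain i where i: "1 \<le> i" "i \<le> k - 1" and sub: "{i..<i + p} \<subseteq> T \<union> {k..<k + p}"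
          by (auto simp: path_gens_def)
        show "\<exists>A\<in>insert {k - 1} (path_gens p l). A \<subseteq> T"
        \<comment> \<open>If \<open>i \<le> l\<close>, window \<open>i\<close> ends before
          \<open>k\<close> and lies in \<open>T\<close>. Otherwise it contains \<open>k - 1\<close>,
          which is outside window \<open>k\<close> and hence in \<open>T\<close>.\<close>
        proof (cases "i \<le> l")
          case True
          then have "{i..<i + p} \<inter> {k..<k + p} = {}"
            using i by (auto simp: l_def)
          moreover have "{i..<i + p} \<in> path_gens p l"
            using i True by (auto simp: path_gens_def)
          ultimately show ?thesis
            using sub by blast
        next
          case False
          then have "k - 1 \<in> {i..<i + p}"
            using i by (auto simp: l_def)
          then have "k - 1 \<in> T \<union> {k..<k + p}"
            using sub by blast
          then have "k - 1 \<in> T"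
            using 3 by auto
          then show ?thesis by blast
        qed
      next
        assume "\<exists>A\<in>insert {k - 1} (path_gens p l). A \<subseteq> T"
        then show "\<exists>A\<in>path_gens p (k - 1). A \<subseteq> T \<union> {k..<k + p}"
          using prev prev_sub gens_sub by blast
      qed
    qed (use less.prems 3 p in auto)
    moreover have "insert {k..<k + p} (path_gens p (k - 1)) = path_gens p k"
      using path_gens_Suc[of p "k - 1"] 3 by simp
    ultimately show ?thesis
      using path_pdim_rec[OF 3, of p] by (simp add: l_def)
  qed
qed

lemma path_ideal_eq:
  assumes "n \<ge> 1"
  shows "path_ideal p (n + p - 1) = (sqfree_ideal (n + p - 1) (path_gens p n) :: 'k::field mpoly set)"
proof -
  \<comment> \<open>As \<open>n \<ge> 1\<close>, subtraction is exact and the bound on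
    \<open>i\<close> becomes \<open>i \<le> n\<close>.\<close>
  have eq: "{\<Prod>j\<in>{i..<i + p}. mvar j | i. 1 \<le> i \<and> i + p \<le> n + p - 1 + 1}
      = ((\<lambda>A. \<Prod>i\<in>A. mvar i) ` path_gens p n :: 'k mpoly set)"
    using assms by (auto simp: path_gens_def)
  show ?thesis
    unfolding path_ideal_def eq by (rule genideal_prod_mvar) (auto simp: path_gens_def)
qed

theorem corollary3p18:
  fixes p n q s :: nat
    and R :: "((nat \<Rightarrow>\<^sub>0 nat) \<Rightarrow>\<^sub>0 'k::field) ring"
  assumes "p \<ge> 1" and "n \<ge> 1"
    and "n = (p + 1) * q + s" and "s \<le> p"
    and "R = mpoly_ring (n + p - 1)"
  shows "pdim R (quot_module R (path_ideal p (n + p - 1))) =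
    enat (if s = 0 then 2 * q else if s = 1 then 2 * q + 1 else 2 * q + 2)"
proof -
  have "pdim R (quot_module R (path_ideal p (n + p - 1))) = enat (path_pdim p n)"
    unfolding assms(5) mpoly_ring_eq path_ideal_eq[OF assms(2)]
    by (rule mpoly.pdim_quot_module[OF ideal_sqfree_ideal has_min_res_path[OF assms(1)]])
      (use assms(2) in simp)
  \<comment> \<open>\<open>s \<le> p\<close> makes \<open>q\<close> and \<open>s\<close> the
    quotient and remainder by \<open>p + 1\<close>.\<close>
  moreover have "n div (p + 1) = q" "n mod (p + 1) = s"
    using assms(4) unfolding assms(3) by (simp_all del: mult_Suc)
  ultimately show ?thesis
    by (simp add: path_pdim_def)
qed

end
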